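(* For every $T_0$ Alexandroff space $X$, there are a topological space $Y$ weakly homotopy equivalent to $X$ and a topological embedding $\varphi:Y\to 2^{X_d}_u$ such that $\varphi(Y)$ is open in $2^{X_d}_u$. If $X$ is locally finite, the embedding is into $2^{X_d}_f$.
   Context: An Alexandroff space is a topological space in which arbitrary intersections of open sets are open. A topological space is locally finite if every point has a finite neighborhood. For a set $X$ (here the underlying set of the space), let $X_d$ be $X$ with the discrete topology. $2^{X_d}_u$ denotes the set of all non-empty subsets of $X$ with the upper semifinite topology, i.e. the topology generated by the base of sets $B(U)=\{C\subseteq X: C\neq\emptyset,\ C\subseteq U\}$, $U\subseteq X$. $2^{X_d}_f\subset 2^{X_d}_u$ is the subspace of finite non-empty subsets of $X$, with the subspace topology. *)

theory Defs
  imports "HOL-Analysis.Analysis" "HOL-Algebra.Group"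
begin

section \<open>Alexandroff spaces and the upper semifinite hyperspace\<close>

definition alexandroff_space :: "'a topology \<Rightarrow> bool" where
  "alexandroff_space X \<longleftrightarrow>
     (\<forall>\<U>. \<U> \<noteq> {} \<and> (\<forall>U\<in>\<U>. openin X U) \<longrightarrow> openin X (\<Inter>\<U>))"

definition locally_finite_space :: "'a topology \<Rightarrow> bool" where
  "locally_finite_space X \<longleftrightarrow>
     (\<forall>x\<in>topspace X. \<exists>N U. N \<subseteq> topspace X \<and> finite N \<and> openin X U \<and> x \<in> U \<and> U \<subseteq> N)"

text \<open>The spaces $2^{S_d}_u$ and $2^{S_d}_f$ for the discrete space on \<open>S\<close>.\<close>

definition usf_hyperspace :: "'a set \<Rightarrow> 'a set topology" where
  "usf_hyperspace S = topology_generated_by {{C. C \<noteq> {} \<and> C \<subseteq> U} | U. U \<subseteq> S}"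

definition finite_usf_hyperspace :: "'a set \<Rightarrow> 'a set topology" where
  "finite_usf_hyperspace S = subtopology (usf_hyperspace S) {C. finite C}"

section \<open>Homotopy groups\<close>

text \<open>
  Points of the \<open>n\<close>-cube are functions on \<open>nat\<close> that are \<open>undefined\<close> outside
  \<open>{..<n}\<close>. Maps are HOL functions whose values off the cube are irrelevant; they are
  identified by passing to homotopy classes relative to the boundary.
\<close>

definition unit_cube :: "nat \<Rightarrow> (nat \<Rightarrow> real) topology" where
  "unit_cube n = product_topology (\<lambda>_. top_of_set {0..1}) {..<n}"

definition cube_boundary :: "nat \<Rightarrow> (nat \<Rightarrow> real) set" where
  "cube_boundary n = {t \<in> topspace (unit_cube n). \<exists>i<n. t i = 0 \<or> t i = 1}"

definition spheroids :: "nat \<Rightarrow> 'a topology \<Rightarrow> 'a \<Rightarrow> ((nat \<Rightarrow> real) \<Rightarrow> 'a) set" where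
  "spheroids n X x = {g. continuous_map (unit_cube n) X g \<and> (\<forall>t\<in>cube_boundary n. g t = x)}"

definition spheroid_homotopic ::
  "nat \<Rightarrow> 'a topology \<Rightarrow> 'a \<Rightarrow> ((nat \<Rightarrow> real) \<Rightarrow> 'a) \<Rightarrow> ((nat \<Rightarrow> real) \<Rightarrow> 'a) \<Rightarrow> bool" where
  "spheroid_homotopic n X x =
     homotopic_with (\<lambda>g. \<forall>t\<in>cube_boundary n. g t = x) (unit_cube n) X"

definition spheroid_class ::
  "nat \<Rightarrow> 'a topology \<Rightarrow> 'a \<Rightarrow> ((nat \<Rightarrow> real) \<Rightarrow> 'a) \<Rightarrow> ((nat \<Rightarrow> real) \<Rightarrow> 'a) set" where
  "spheroid_class n X x g = {h. spheroid_homotopic n X x g h}"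

definition spheroid_concat ::
  "((nat \<Rightarrow> real) \<Rightarrow> 'a) \<Rightarrow> ((nat \<Rightarrow> real) \<Rightarrow> 'a) \<Rightarrow> (nat \<Rightarrow> real) \<Rightarrow> 'a" where
  "spheroid_concat g h t =
     (if t 0 \<le> 1/2 then g (t(0 := 2 * t 0)) else h (t(0 := 2 * t 0 - 1)))"

text \<open>The group $\pi_n(X,x)$; the multiplication is meaningful for \<open>n \<ge> 1\<close> only.\<close>

definition homotopy_group ::
  "nat \<Rightarrow> 'a topology \<Rightarrow> 'a \<Rightarrow> ((nat \<Rightarrow> real) \<Rightarrow> 'a) set monoid" where
  "homotopy_group n X x =
     \<lparr>carrier = spheroid_class n X x ` spheroids n X x,
      mult = (\<lambda>A B. \<Union>g\<in>A. \<Union>h\<in>B. spheroid_class n X x (spheroid_concat g h)),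
      one = spheroid_class n X x (\<lambda>_. x)\<rparr>"

text \<open>
  The maps induced by a continuous \<open>f\<close> on $\pi_0$ and $\pi_n$. The unions avoid a choice of
  representatives: all the sets united are the same component or class.
\<close>

definition path_components_induced ::
  "'b topology \<Rightarrow> ('a \<Rightarrow> 'b) \<Rightarrow> 'a set \<Rightarrow> 'b set" where
  "path_components_induced Y f C = (\<Union>x\<in>C. path_component_of_set Y (f x))"

definition homotopy_group_induced ::
  "nat \<Rightarrow> 'b topology \<Rightarrow> ('a \<Rightarrow> 'b) \<Rightarrow> 'a \<Rightarrow>
   ((nat \<Rightarrow> real) \<Rightarrow> 'a) set \<Rightarrow> ((nat \<Rightarrow> real) \<Rightarrow> 'b) set" where
  "homotopy_group_induced n Y f x A = (\<Union>g\<in>A. spheroid_class n Y (f x) (f \<circ> g))"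

section \<open>Weak homotopy equivalence\<close>

definition weak_homotopy_equivalence ::
  "'a topology \<Rightarrow> 'b topology \<Rightarrow> ('a \<Rightarrow> 'b) \<Rightarrow> bool" where
  "weak_homotopy_equivalence X Y f \<longleftrightarrow>
     continuous_map X Y f \<and>
     bij_betw (path_components_induced Y f) (path_components_of X) (path_components_of Y) \<and>
     (\<forall>n\<ge>1. \<forall>x\<in>topspace X.
        homotopy_group_induced n Y f x \<in> iso (homotopy_group n X x) (homotopy_group n Y (f x)))"

text \<open>
  Spaces are weakly homotopy equivalent if they are joined by a finite zigzag of weak homotopy
  equivalences. HOL cannot quantify over the types of the intermediate spaces, so the zigzag
  runs between homeomorphic copies of \<open>X\<close> and \<open>Y\<close> in one fixed type. This is no restriction:
  every zigzag, in whatever universe, can be replaced by one through the geometric realizations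
  of the singular complexes of \<open>X\<close> and \<open>Y\<close>, and
  \<open>real \<Rightarrow> 'a + 'b\<close> has enough elements to carry these realizations.
\<close>

definition weakly_homotopy_equivalent :: "'a topology \<Rightarrow> 'b topology \<Rightarrow> bool" where
  "weakly_homotopy_equivalent X Y \<longleftrightarrow>
     (\<exists>(X' :: (real \<Rightarrow> 'a + 'b) topology) Y'.
        X homeomorphic_space X' \<and> Y homeomorphic_space Y' \<and>
        equivclp (\<lambda>V W. \<exists>f. weak_homotopy_equivalence V W f) X' Y')"

end

theory Submission
  imports Defs
begin

text \<open>
  In an Alexandroff space every point has a least neighbourhood, and \<open>x \<in> min_nbhd X y\<close>
  (read: \<open>x\<close> lies below \<open>y\<close>) is a preorder whose down-sets are the open sets. The space \<open>Y\<close> is the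
  set of non-empty finite chains of this preorder, that is, the face poset of its order complex, as a
  subspace of the hyperspace. The open sets of the hyperspace are the families of non-empty sets that
  are closed under passing to non-empty subsets; the finite chains form such a family, so \<open>Y\<close> is open,
  the embedding is the inclusion, and it takes values in the finite sets.

  What has to be proved is a case of McCord's theorem: the map \<open>chain_top\<close>, which sends a chain to its
  largest element, is a weak homotopy equivalence from \<open>Y\<close> to \<open>X\<close>. Instead of gluing local
  equivalences over the cover by least neighbourhoods, the proof lifts maps directly. Let \<open>b\<close> be a map
  from a compact metric space into \<open>X\<close>. Around each point \<open>t\<close> choose a radius \<open>r t\<close> such that \<open>b\<close>
  sends the ball of radius \<open>3 * r t\<close> into the least neighbourhood of \<open>b t\<close>, and cover the space by
  finitely many closed balls of radius \<open>r t\<close>. If two of these meet, the larger one, enlarged three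
  times, contains the centre of the smaller, so the values of \<open>b\<close> at the two centres are comparable.
  Hence the values at the centres of the balls around a given point \<open>p\<close> form a finite chain \<open>g p\<close>.
  Since the balls are closed and finite in number, \<open>g s \<subseteq> g p\<close> for all \<open>s\<close> near \<open>p\<close>, which is
  continuity of \<open>g\<close>. Finally \<open>b p\<close> lies below the largest element of \<open>g p\<close>, and maps into an
  Alexandroff space that are comparable pointwise are homotopic.

  The relative form of this construction (\<open>chain_lift\<close>) keeps a lift that is already given near a
  closed set. Applied to cylinders over cubes it yields surjectivity and injectivity on path components
  and on homotopy groups; the only preparation needed is to make the maps constant near the boundary
  of the cube, by a piecewise linear stretching of each coordinate.
\<close>

section \<open>Minimal neighbourhoods in Alexandroff spaces\<close>

definition min_nbhd :: "'a topology \<Rightarrow> 'a \<Rightarrow> 'a set" where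
  "min_nbhd X x = \<Inter>{U. openin X U \<and> x \<in> U}"

lemma min_nbhd_subset: "openin X U \<Longrightarrow> x \<in> U \<Longrightarrow> min_nbhd X x \<subseteq> U"
  by (auto simp: min_nbhd_def)

lemma min_nbhd_refl: "x \<in> min_nbhd X x"
  by (auto simp: min_nbhd_def)

lemma min_nbhd_trans: "x \<in> min_nbhd X y \<Longrightarrow> y \<in> min_nbhd X z \<Longrightarrow> x \<in> min_nbhd X z"
  by (auto simp: min_nbhd_def)

lemma openin_min_nbhd:
  assumes "alexandroff_space X" "x \<in> topspace X"
  shows "openin X (min_nbhd X x)"
proof -
  have "{U. openin X U \<and> x \<in> U} \<noteq> {}"
    using assms(2) openin_topspace by blast
  then show ?thesis
    using assms(1)[unfolded alexandroff_space_def, rule_format, of "{U. openin X U \<and> x \<in> U}"]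
    by (simp add: min_nbhd_def)
qed

lemma min_nbhd_eqI:
  assumes "openin X U" "x \<in> U" "\<And>V. openin X V \<Longrightarrow> x \<in> V \<Longrightarrow> U \<subseteq> V"
  shows "min_nbhd X x = U"
  using assms by (auto simp: min_nbhd_def)

text \<open>
  Continuity at \<open>t\<close> is a condition on a single neighbourhood of \<open>g t\<close>, the least one.
\<close>

lemma continuous_map_into_alexandroff:
  assumes "alexandroff_space X"
  shows "continuous_map T X g \<longleftrightarrow>
    g \<in> topspace T \<rightarrow> topspace X \<and>
    (\<forall>t\<in>topspace T. \<exists>V. openin T V \<and> t \<in> V \<and> (\<forall>s\<in>V. g s \<in> min_nbhd X (g t)))"
  (is "?L \<longleftrightarrow> ?R")
proof
  assume L: ?L
  have "\<exists>V. openin T V \<and> t \<in> V \<and> (\<forall>s\<in>V. g s \<in> min_nbhd X (g t))" if t: "t \<in> topspace T" for t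
  proof (intro exI conjI)
    have "g t \<in> topspace X" using L t by (auto simp: continuous_map_def)
    then show "openin T {s \<in> topspace T. g s \<in> min_nbhd X (g t)}"
      using openin_continuous_map_preimage[OF L] openin_min_nbhd[OF assms] by blast
  qed (use t min_nbhd_refl in auto)
  then show ?R using L by (auto simp: continuous_map_def)
next
  assume R: ?R
  have "openin T {s \<in> topspace T. g s \<in> U}" if U: "openin X U" for U
  proof (subst openin_subopen, clarify)
    fix t assume t: "t \<in> topspace T" "g t \<in> U"
    then obtain V where V: "openin T V" "t \<in> V" "\<forall>s\<in>V. g s \<in> min_nbhd X (g t)"
      using R by blast
    then have "V \<subseteq> {s \<in> topspace T. g s \<in> U}"
      using min_nbhd_subset[OF U t(2)] openin_subset by blast
    then show "\<exists>V. openin T V \<and> t \<in> V \<and> V \<subseteq> {s \<in> topspace T. g s \<in> U}"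
      using V by blast
  qed
  then show ?L using R by (simp add: continuous_map_def)
qed

lemma continuous_map_into_alexandroffD:
  assumes "alexandroff_space X" "continuous_map T X g" "t \<in> topspace T"
  obtains V where "openin T V" "t \<in> V" "\<And>s. s \<in> V \<Longrightarrow> g s \<in> min_nbhd X (g t)"
  using assms continuous_map_into_alexandroff by metis

text \<open>
  The homotopy stays at the lower map \<open>b\<close> for all times less than \<open>1\<close> and jumps to \<open>c\<close> at time \<open>1\<close>.
  This is continuous because a neighbourhood of \<open>c t\<close> contains \<open>b t\<close>, and it does not move a point at
  which \<open>b\<close> and \<open>c\<close> agree.
\<close>

lemma homotopic_with_comparable:
  assumes X: "alexandroff_space X" and b: "continuous_map T X b" and c: "continuous_map T X c"
    and le: "\<And>t. t \<in> topspace T \<Longrightarrow> b t \<in> min_nbhd X (c t)"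
    and eq: "\<And>t. t \<in> A \<Longrightarrow> c t = b t"
  shows "homotopic_with (\<lambda>h. \<forall>t\<in>A. h t = b t) T X b c"
proof -
  define H where "H = (\<lambda>(s::real, t). if s < 1 then b t else c t)"
  let ?I = "top_of_set {0..1::real}"
  have "continuous_map (prod_topology ?I T) X H"
    unfolding continuous_map_into_alexandroff[OF X]
  proof (intro conjI ballI)
    show "H \<in> topspace (prod_topology ?I T) \<rightarrow> topspace X"
      using b c by (auto simp: H_def continuous_map_def)
    fix p assume p: "p \<in> topspace (prod_topology ?I T)"
    obtain s t where st: "p = (s, t)" "s \<in> {0..1}" "t \<in> topspace T" using p by auto
    obtain V where V: "openin T V" "t \<in> V" "\<And>s. s \<in> V \<Longrightarrow> b s \<in> min_nbhd X (b t)"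
      using continuous_map_into_alexandroffD[OF X b st(3)] by metis
    obtain V' where V': "openin T V'" "t \<in> V'" "\<And>s. s \<in> V' \<Longrightarrow> c s \<in> min_nbhd X (c t)"
      using continuous_map_into_alexandroffD[OF X c st(3)] by metis
    show "\<exists>U. openin (prod_topology ?I T) U \<and> p \<in> U \<and> (\<forall>q\<in>U. H q \<in> min_nbhd X (H p))"
    proof (cases "s < 1")
      case True
      have "openin ?I ({0..1} \<inter> {..<1})"
        by (simp add: openin_open_Int)
      then have "openin (prod_topology ?I T) (({0..1} \<inter> {..<1}) \<times> V)"
        using V(1) by (simp add: openin_prod_Times_iff)
      then show ?thesis
        using V st True by (intro exI[of _ "({0..1} \<inter> {..<1}) \<times> V"]) (auto simp: H_def)
    next
      case False
      have "openin (prod_topology ?I T) ({0..1} \<times> (V \<inter> V'))"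
        using V(1) V'(1) by (simp add: openin_prod_Times_iff openin_Int)
      moreover have "b u \<in> min_nbhd X (c t)" if "u \<in> V" for u
        using V(3)[OF that] le[OF st(3)] min_nbhd_trans by metis
      ultimately show ?thesis
        using V V' st False by (intro exI[of _ "{0..1} \<times> (V \<inter> V')"]) (auto simp: H_def)
    qed
  qed
  then show ?thesis
    unfolding homotopic_with_def
    by (intro exI[of _ H]) (auto simp: H_def eq)
qed

section \<open>The space of finite chains\<close>

lemma openin_usf_hyperspace:
  "openin (usf_hyperspace S) \<O> \<longleftrightarrow>
     (\<forall>C\<in>\<O>. C \<noteq> {} \<and> C \<subseteq> S) \<and> (\<forall>C\<in>\<O>. \<forall>D. D \<noteq> {} \<longrightarrow> D \<subseteq> C \<longrightarrow> D \<in> \<O>)"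
  (is "_ \<longleftrightarrow> ?R \<O>")
proof
  assume "openin (usf_hyperspace S) \<O>"
  then have "generate_topology_on {{C. C \<noteq> {} \<and> C \<subseteq> U} | U. U \<subseteq> S} \<O>"
    by (simp add: usf_hyperspace_def openin_topology_generated_by)
  then show "?R \<O>"
  proof (induction rule: generate_topology_on.induct)
    case Empty
    show ?case by simp
  next
    case (Int a b)
    then show ?case by (meson IntE IntI)
  next
    case (UN K)
    then show ?case by (meson UnionE UnionI)
  next
    case (Basis s)
    then obtain U where "s = {C. C \<noteq> {} \<and> C \<subseteq> U}" "U \<subseteq> S" by blast
    then show ?case by (simp add: subset_iff)
  qed
next
  assume R: "?R \<O>"
  have "\<O> = (\<Union>U\<in>\<O>. {C. C \<noteq> {} \<and> C \<subseteq> U})"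

  proof (intro subset_antisym subsetI)
    fix C assume "C \<in> \<O>"
    then show "C \<in> (\<Union>U\<in>\<O>. {C. C \<noteq> {} \<and> C \<subseteq> U})" 
      using R[THEN conjunct1, rule_format, of C] by (intro UN_I[of C]) simp_all
  next
    fix C assume "C \<in> (\<Union>U\<in>\<O>. {C. C \<noteq> {} \<and> C \<subseteq> U})"
    then obtain U where "U \<in> \<O>" "C \<noteq> {}" "C \<subseteq> U" by blast
    then show "C \<in> \<O>" using R[THEN conjunct2, rule_format, of U C] by simp
  qed
  moreover have "openin (usf_hyperspace S) {C. C \<noteq> {} \<and> C \<subseteq> U}" if "U \<in> \<O>" for U
  proof -
    have "U \<subseteq> S" using R[THEN conjunct1, rule_format, OF that] by simp
    then show ?thesis
      unfolding usf_hyperspace_def by (intro topology_generated_by_Basis) blast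
  qed
  ultimately show "openin (usf_hyperspace S) \<O>"
    by (metis (no_types, lifting) imageE openin_Union)
qed

definition finite_chains :: "'a topology \<Rightarrow> 'a set set" where
  "finite_chains X = {C. finite C \<and> C \<noteq> {} \<and> C \<subseteq> topspace X \<and>
     (\<forall>x\<in>C. \<forall>y\<in>C. x \<in> min_nbhd X y \<or> y \<in> min_nbhd X x)}"

text \<open>
  The face poset of the order complex of \<open>X\<close>: its open sets are the families of chains that are closed
  under passing to non-empty subchains.
\<close>

definition chain_space :: "'a topology \<Rightarrow> 'a set topology" where
  "chain_space X = subtopology (usf_hyperspace (topspace X)) (finite_chains X)"

lemma finite_chains_subset:
  "C \<in> finite_chains X \<Longrightarrow> D \<subseteq> C \<Longrightarrow> D \<noteq> {} \<Longrightarrow> D \<in> finite_chains X"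
  unfolding finite_chains_def by (auto intro: finite_subset)

lemma openin_finite_chains: "openin (usf_hyperspace (topspace X)) (finite_chains X)"
  unfolding openin_usf_hyperspace
proof (intro conjI ballI allI impI)
  fix C assume C: "C \<in> finite_chains X"
  then show "C \<noteq> {}" "C \<subseteq> topspace X" by (simp_all add: finite_chains_def)
  show "D \<in> finite_chains X" if "D \<noteq> {}" "D \<subseteq> C" for D
    using finite_chains_subset[OF C that(2,1)] .
qed

lemma openin_chain_space:
  "openin (chain_space X) \<O> \<longleftrightarrow>
     \<O> \<subseteq> finite_chains X \<and> (\<forall>C\<in>\<O>. \<forall>D. D \<noteq> {} \<longrightarrow> D \<subseteq> C \<longrightarrow> D \<in> \<O>)"
proof -
  have "openin (chain_space X) \<O> \<longleftrightarrow> openin (usf_hyperspace (topspace X)) \<O> \<and> \<O> \<subseteq> finite_chains X"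
    unfolding chain_space_def by (rule openin_open_subtopology[OF openin_finite_chains])
  moreover have "C \<noteq> {} \<and> C \<subseteq> topspace X" if "C \<in> finite_chains X" for C
    using that by (simp add: finite_chains_def)
  ultimately show ?thesis
    unfolding openin_usf_hyperspace by (meson subsetD)
qed

lemma topspace_chain_space: "topspace (chain_space X) = finite_chains X"
proof
  show "topspace (chain_space X) \<subseteq> finite_chains X"
    by (simp add: chain_space_def)
  show "finite_chains X \<subseteq> topspace (chain_space X)"
    by (rule openin_subset) (auto simp: openin_chain_space intro: finite_chains_subset)
qed

lemma alexandroff_chain_space: "alexandroff_space (chain_space X)"
  unfolding alexandroff_space_def
proof (intro allI impI, elim conjE)
  fix \<U> assume "\<U> \<noteq> {}" and \<U>: "\<forall>U\<in>\<U>. openin (chain_space X) U"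
  then obtain U where "U \<in> \<U>" by blast
  with \<U> have "\<Inter>\<U> \<subseteq> finite_chains X" by (meson Inter_lower openin_chain_space subset_trans)
  moreover have "D \<in> \<Inter>\<U>" if "C \<in> \<Inter>\<U>" "D \<noteq> {}" "D \<subseteq> C" for C D
    using that \<U> by (meson InterD InterI openin_chain_space)
  ultimately show "openin (chain_space X) (\<Inter>\<U>)"
    unfolding openin_chain_space by blast
qed

lemma min_nbhd_chain_space:
  assumes "C \<in> finite_chains X"
  shows "min_nbhd (chain_space X) C = {D. D \<noteq> {} \<and> D \<subseteq> C}"
proof (rule min_nbhd_eqI)
  show "openin (chain_space X) {D. D \<noteq> {} \<and> D \<subseteq> C}"
    using assms finite_chains_subset by (auto simp: openin_chain_space)
  show "C \<in> {D. D \<noteq> {} \<and> D \<subseteq> C}"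
    using assms by (simp add: finite_chains_def)
qed (auto simp: openin_chain_space)

text \<open>
  The choice is immaterial: two elements that are above all others have the same least neighbourhood.
\<close>

definition chain_top :: "'a topology \<Rightarrow> 'a set \<Rightarrow> 'a" where
  "chain_top X C = (SOME m. m \<in> C \<and> C \<subseteq> min_nbhd X m)"

lemma chain_top:
  assumes "C \<in> finite_chains X"
  shows "chain_top X C \<in> C" "C \<subseteq> min_nbhd X (chain_top X C)"
proof -
  have "\<exists>m\<in>C. C \<subseteq> min_nbhd X m"
    if "finite C" "C \<noteq> {}" "\<forall>x\<in>C. \<forall>y\<in>C. x \<in> min_nbhd X y \<or> y \<in> min_nbhd X x"
    using that
  proof (induction rule: finite_ne_induct)
    case (singleton x) then show ?case by (simp add: min_nbhd_refl)
  next
    case (insert x F)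
    then obtain m where m: "m \<in> F" "F \<subseteq> min_nbhd X m" by auto
    then consider "x \<in> min_nbhd X m" | "m \<in> min_nbhd X x" using insert.prems by blast
    then show ?case
    proof cases
      case 1 then show ?thesis using m by blast
    next
      case 2
      then have "insert x F \<subseteq> min_nbhd X x"
        using m min_nbhd_trans min_nbhd_refl by (metis insert_subset subset_iff)
      then show ?thesis by blast
    qed
  qed
  then have "\<exists>m. m \<in> C \<and> C \<subseteq> min_nbhd X m"
    using assms by (auto simp: finite_chains_def)
  from someI_ex[OF this] show "chain_top X C \<in> C" "C \<subseteq> min_nbhd X (chain_top X C)"
    by (auto simp: chain_top_def)
qed

lemma continuous_map_chain_top:
  assumes "alexandroff_space X"
  shows "continuous_map (chain_space X) X (chain_top X)"
  unfolding continuous_map_into_alexandroff[OF assms] topspace_chain_space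
proof (intro conjI ballI)
  show "chain_top X \<in> finite_chains X \<rightarrow> topspace X"
    using chain_top(1) unfolding finite_chains_def by (intro funcsetI) blast
  fix C assume C: "C \<in> finite_chains X"
  have "chain_top X D \<in> min_nbhd X (chain_top X C)" if "D \<noteq> {}" "D \<subseteq> C" for D
    using chain_top(1)[OF finite_chains_subset[OF C that(2,1)]] chain_top(2)[OF C] that by blast
  moreover have "openin (chain_space X) {D. D \<noteq> {} \<and> D \<subseteq> C}"
    using openin_min_nbhd[OF alexandroff_chain_space, of C X] C
    by (simp add: min_nbhd_chain_space topspace_chain_space)
  moreover have "C \<in> {D. D \<noteq> {} \<and> D \<subseteq> C}"
    using C by (simp add: finite_chains_def)
  ultimately show "\<exists>V. openin (chain_space X) V \<and> C \<in> V \<and>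
      (\<forall>D\<in>V. chain_top X D \<in> min_nbhd X (chain_top X C))"
    by (intro exI[of _ "{D. D \<noteq> {} \<and> D \<subseteq> C}"]) simp
qed

section \<open>Finite closed covers with comparable centres\<close>

text \<open>
  The combinatorial core. The sets \<open>K j\<close> are closed balls around \<open>j\<close> whose radius \<open>\<rho> j\<close> is a third
  of the radius of a ball inside \<open>W j\<close>; the triangle inequality turns an intersection of two of
  them into membership of one centre in the neighbourhood chosen for the other. The radii are kept
  because they single out, among all balls that contain a given point, one centre whose neighbourhood
  contains all the other centres.
\<close>

lemma comparable_cover:
  assumes T: "compact_space T" "metrizable_space T"
    and W: "\<And>t. t \<in> topspace T \<Longrightarrow> openin T (W t) \<and> t \<in> W t"
  obtains F K and \<rho> :: "'a \<Rightarrow> real" where "finite F" "F \<subseteq> topspace T"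
    "\<And>j. j \<in> F \<Longrightarrow> closedin T (K j)" "\<And>j. j \<in> F \<Longrightarrow> K j \<subseteq> W j" "topspace T \<subseteq> (\<Union>j\<in>F. K j)"
    "\<And>i j. i \<in> F \<Longrightarrow> j \<in> F \<Longrightarrow> \<rho> j \<le> \<rho> i \<Longrightarrow> K i \<inter> K j \<noteq> {} \<Longrightarrow> j \<in> W i"
proof -
  obtain M d where Md: "Metric_space M d" and T_eq: "T = Metric_space.mtopology M d"
    using T(2) by (auto simp: metrizable_space_def)
  interpret Metric_space M d by (fact Md)
  have top: "topspace T = M" by (simp add: T_eq)
  have "\<exists>e>0. mball t e \<subseteq> W t" if "t \<in> M" for t
    using W[of t] that by (auto simp: T_eq openin_mtopology)
  then obtain e where e: "\<And>t. t \<in> M \<Longrightarrow> e t > 0 \<and> mball t (e t) \<subseteq> W t" by metis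
  define r where "r t = e t / 3" for t
  have r: "r t > 0" "mball t (3 * r t) \<subseteq> W t" if "t \<in> M" for t
    using e[OF that] by (auto simp: r_def)
  obtain \<F> where \<F>: "finite \<F>" "\<F> \<subseteq> (\<lambda>t. mball t (r t)) ` M" "topspace T \<subseteq> \<Union>\<F>"
  proof -
    have "\<forall>U\<in>(\<lambda>t. mball t (r t)) ` M. openin T U" by (auto simp: T_eq)
    moreover have "topspace T \<subseteq> \<Union>((\<lambda>t. mball t (r t)) ` M)" using r by (auto simp: top)
    ultimately show thesis
      using T(1) that unfolding compact_space_alt by meson
  qed
  obtain F where F: "finite F" "F \<subseteq> M" "\<F> = (\<lambda>t. mball t (r t)) ` F"
    using finite_subset_image[OF \<F>(1,2)] by blast
  show thesis
  proof (rule that)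
    show "finite F" "F \<subseteq> topspace T" using F by (auto simp: top)
    show "closedin T (mcball j (r j))" if "j \<in> F" for j by (simp add: T_eq)
    show "mcball j (r j) \<subseteq> W j" if "j \<in> F" for j
    proof -
      have "j \<in> M" using that F by auto
      then show ?thesis
        using r[of j] by (auto simp: subset_iff)
    qed
    show "topspace T \<subseteq> (\<Union>j\<in>F. mcball j (r j))"
      using \<F>(3) F(3) mball_subset_mcball by fastforce
    show "j \<in> W i" if ij: "i \<in> F" "j \<in> F" "r j \<le> r i" and ne: "mcball i (r i) \<inter> mcball j (r j) \<noteq> {}" for i j
    proof -
      obtain p where p: "p \<in> M" "d i p \<le> r i" "d j p \<le> r j" using ne by auto
      have M: "i \<in> M" "j \<in> M" using ij F by auto
      have "d i j \<le> d i p + d p j" using triangle M p by blast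
      then have "d i j < 3 * r i" using p ij(3) r(1)[OF M(1)] commute[of j p] by simp
      then show ?thesis using r(2)[OF M(1)] M by auto
    qed
  qed
qed


section \<open>Lifting to the space of chains\<close>

text \<open>
  Let \<open>U\<close> be open with \<open>A \<subseteq> U\<close> and closure \<open>C1 \<subseteq> N\<close>, and let \<open>C2\<close> be the complement of \<open>U\<close>. The lift is
  the given \<open>a\<close> on \<open>U\<close>, the chain of values of \<open>b\<close> at the centres of a comparable cover off \<open>C1\<close>, and the
  union of both where \<open>C1\<close> and \<open>C2\<close> overlap. That this union is a chain is arranged by the choice of the
  neighbourhoods \<open>W t\<close>: for \<open>t \<in> N\<close> the map \<open>a\<close> takes only subsets of \<open>a t\<close> there, while for
  \<open>t \<notin> N\<close> they avoid \<open>C1\<close>. So only balls with centres in \<open>N\<close> contain a point of \<open>C1\<close>, and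
  everything lies inside the chain \<open>a m\<close> for the centre \<open>m\<close> of the largest ball.
\<close>

lemma chain_lift:
  assumes X: "alexandroff_space X" and T: "compact_space T" "metrizable_space T"
    and A: "closedin T A" "A \<subseteq> N" and N: "openin T N"
    and a: "continuous_map (subtopology T N) (chain_space X) a" and b: "continuous_map T X b"
    and ab: "\<And>t. t \<in> N \<Longrightarrow> chain_top X (a t) = b t"
  obtains g where "continuous_map T (chain_space X) g" "\<And>t. t \<in> A \<Longrightarrow> g t = a t"
    "\<And>t. t \<in> topspace T \<Longrightarrow> b t \<in> min_nbhd X (chain_top X (g t))"
proof -
  have "normal_space T" using T(2) by (rule metrizable_imp_normal_space)
  then obtain U where U: "openin T U" "A \<subseteq> U" "T closure_of U \<subseteq> N"
    using A N unfolding normal_space_alt by meson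
  define C1 where "C1 = T closure_of U"
  define C2 where "C2 = topspace T - U"
  have C: "closedin T C1" "closedin T C2" "U \<subseteq> C1" "C1 \<subseteq> N"
    using U openin_subset[OF U(1)] by (auto simp: C1_def C2_def closure_of_subset)
  have NT: "N \<subseteq> topspace T" using N by (rule openin_subset)
  have a_chain: "a t \<in> finite_chains X" if "t \<in> N" for t
    using a that NT by (auto simp: continuous_map_def topspace_chain_space Pi_iff)
  have b_in: "b t \<in> topspace X" if "t \<in> topspace T" for t
    using b that by (auto simp: continuous_map_def)
  have a_nbhd: "\<exists>W. openin T W \<and> t \<in> W \<and> W \<subseteq> N \<and> (\<forall>s\<in>W. a s \<subseteq> a t)" if t: "t \<in> N" for t
  proof -
    have "t \<in> topspace (subtopology T N)" using t NT by auto
    then obtain V where V: "openin (subtopology T N) V" "t \<in> V"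
      "\<And>s. s \<in> V \<Longrightarrow> a s \<in> min_nbhd (chain_space X) (a t)"
      using continuous_map_into_alexandroffD[OF alexandroff_chain_space a] by metis
    then have "openin T V" "V \<subseteq> N" using openin_open_subtopology[OF N] by auto
    then show ?thesis using V min_nbhd_chain_space[OF a_chain[OF t]] by (intro exI[of _ V]) auto
  qed
  have "\<exists>W. openin T W \<and> t \<in> W \<and> (\<forall>s\<in>W. b s \<in> min_nbhd X (b t)) \<and>
      (t \<in> N \<longrightarrow> W \<subseteq> N \<and> (\<forall>s\<in>W. a s \<subseteq> a t)) \<and> (t \<notin> N \<longrightarrow> W \<inter> C1 = {})"
    if t: "t \<in> topspace T" for t
  proof -
    obtain V where V: "openin T V" "t \<in> V" "\<And>s. s \<in> V \<Longrightarrow> b s \<in> min_nbhd X (b t)"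
      using continuous_map_into_alexandroffD[OF X b t] by metis
    show ?thesis
    proof (cases "t \<in> N")
      case True
      obtain W where "openin T W" "t \<in> W" "W \<subseteq> N" "\<forall>s\<in>W. a s \<subseteq> a t"
        using a_nbhd[OF True] by metis
      then show ?thesis using V True by (intro exI[of _ "V \<inter> W"]) (auto simp: openin_Int)
    next
      case False
      then show ?thesis using V C t
        by (intro exI[of _ "V \<inter> (topspace T - C1)"]) (auto simp: openin_Int)
    qed
  qed
  then have "\<exists>W. \<forall>t\<in>topspace T. openin T (W t) \<and> t \<in> W t \<and> (\<forall>s\<in>W t. b s \<in> min_nbhd X (b t)) \<and>
      (t \<in> N \<longrightarrow> W t \<subseteq> N \<and> (\<forall>s\<in>W t. a s \<subseteq> a t)) \<and> (t \<notin> N \<longrightarrow> W t \<inter> C1 = {})"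
    by (intro bchoice ballI)
  then obtain W where W0: "\<forall>t\<in>topspace T. openin T (W t) \<and> t \<in> W t \<and>
      (\<forall>s\<in>W t. b s \<in> min_nbhd X (b t)) \<and>
      (t \<in> N \<longrightarrow> W t \<subseteq> N \<and> (\<forall>s\<in>W t. a s \<subseteq> a t)) \<and> (t \<notin> N \<longrightarrow> W t \<inter> C1 = {})" ..
  have W: "openin T (W t) \<and> t \<in> W t" if "t \<in> topspace T" for t
    using W0 that by simp
  have Wb: "b s \<in> min_nbhd X (b t)" if "t \<in> topspace T" "s \<in> W t" for s t
    using W0 that by simp
  have Wa: "s \<in> N \<and> a s \<subseteq> a t" if "t \<in> N" "s \<in> W t" for s t
    using W0[rule_format, OF subsetD[OF NT that(1)]] that by auto
  have WN: "W t \<inter> C1 = {}" if "t \<in> topspace T" "t \<notin> N" for t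
    using W0 that by simp
  obtain F K and \<rho> :: "'b \<Rightarrow> real" where F: "finite F" "F \<subseteq> topspace T"
    and K: "\<And>j. j \<in> F \<Longrightarrow> closedin T (K j)" "\<And>j. j \<in> F \<Longrightarrow> K j \<subseteq> W j" "topspace T \<subseteq> (\<Union>j\<in>F. K j)"
    and \<rho>: "\<And>i j. i \<in> F \<Longrightarrow> j \<in> F \<Longrightarrow> \<rho> j \<le> \<rho> i \<Longrightarrow> K i \<inter> K j \<noteq> {} \<Longrightarrow> j \<in> W i"
    using comparable_cover[OF T W] by metis
  define J where "J p = {j \<in> F. p \<in> K j}" for p
  have J: "finite (J p)" "J p \<subseteq> F" for p using F by (auto simp: J_def)
  have J_ne: "J p \<noteq> {}" if "p \<in> topspace T" for p using K(3) that by (auto simp: J_def)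
  have J_W: "p \<in> W j" if "j \<in> J p" for j p using K(2) that by (auto simp: J_def)
  have J_cmp: "j \<in> W i" if "i \<in> J p" "j \<in> J p" "\<rho> j \<le> \<rho> i" for i j p
    using \<rho>[of i j] that by (auto simp: J_def)
  define g where "g p = (if p \<in> C1 then a p else {}) \<union> (if p \<in> C2 then b ` J p else {})" for p
  have J_chain: "b ` J p \<in> finite_chains X" if p: "p \<in> topspace T" for p
    unfolding finite_chains_def
  proof (intro CollectI conjI ballI)
    show "finite (b ` J p)" "b ` J p \<noteq> {}" using J J_ne[OF p] by auto
    show "b ` J p \<subseteq> topspace X" using J F b_in by blast
    fix x y assume "x \<in> b ` J p" "y \<in> b ` J p"
    then obtain i j where ij: "i \<in> J p" "j \<in> J p" "x = b i" "y = b j" by blast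
    have "i \<in> topspace T" "j \<in> topspace T" using ij J F by blast+
    then show "x \<in> min_nbhd X y \<or> y \<in> min_nbhd X x"
      using J_cmp[OF ij(1,2)] J_cmp[OF ij(2,1)] ij Wb by (metis linear)
  qed
  have g_chain: "g p \<in> finite_chains X" if p: "p \<in> topspace T" for p
  proof (cases "p \<in> C1")
    case True
    \<comment> \<open>a ball of maximal radius around \<open>p\<close>: its neighbourhood contains the centres of all the others\<close>
    have "Max (\<rho> ` J p) \<in> \<rho> ` J p" using J J_ne[OF p] by (intro Max_in) auto
    then obtain m where m: "m \<in> J p" "\<rho> m = Max (\<rho> ` J p)" by auto
    have mW: "j \<in> W m" if "j \<in> J p" for j
      using J_cmp[OF m(1) that] m(2) that J(1)[of p] by simp
    have "m \<in> topspace T" using m J F by blast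
    \<comment> \<open>otherwise \<open>W m\<close>, which contains \<open>p\<close>, would avoid \<open>C1\<close>\<close>
    then have mN: "m \<in> N" using WN[of m] J_W[OF m(1)] True by blast
    have "a p \<subseteq> a m" using Wa[OF mN J_W[OF m(1)]] by blast
    moreover have "b j \<in> a m" if "j \<in> J p" for j
    proof -
      have j: "j \<in> N" "a j \<subseteq> a m" using Wa[OF mN mW[OF that]] by auto
      then show ?thesis using chain_top(1)[OF a_chain[OF j(1)]] ab[OF j(1)] by auto
    qed
    ultimately have "g p \<subseteq> a m" by (auto simp: g_def)
    moreover have "g p \<noteq> {}" using True a_chain[of p] C by (auto simp: g_def finite_chains_def)
    ultimately show ?thesis using finite_chains_subset[OF a_chain[OF mN]] by blast
  next
    case False
    then have "p \<in> C2" using C p by (auto simp: C2_def)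
    then show ?thesis using False J_chain[OF p] by (simp add: g_def)
  qed
  show thesis
  proof (rule that)
    show "continuous_map T (chain_space X) g"
      unfolding continuous_map_into_alexandroff[OF alexandroff_chain_space] topspace_chain_space
    proof (intro conjI ballI)
      show "g \<in> topspace T \<rightarrow> finite_chains X" using g_chain by (intro funcsetI)
      fix p assume p: "p \<in> topspace T"
      have 1: "\<exists>V. openin T V \<and> p \<in> V \<and> (\<forall>s\<in>V. s \<in> C1 \<longrightarrow> p \<in> C1 \<and> a s \<subseteq> a p)"
      proof (cases "p \<in> C1")
        case True
        then have "p \<in> N" using C by (meson subsetD)
        then show ?thesis using a_nbhd[of p] True by meson
      next
        case False
        then show ?thesis using C p by (intro exI[of _ "topspace T - C1"]) auto
      qed
      then obtain V1 where V1: "openin T V1" "p \<in> V1" "\<And>s. s \<in> V1 \<Longrightarrow> s \<in> C1 \<Longrightarrow> p \<in> C1 \<and> a s \<subseteq> a p"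
        by metis
      have 2: "\<exists>V. openin T V \<and> p \<in> V \<and> (\<forall>s\<in>V. s \<in> C2 \<longrightarrow> p \<in> C2)"
      proof (cases "p \<in> C2")
        case True
        then show ?thesis using p by (intro exI[of _ "topspace T"]) auto
      next
        case False
        then show ?thesis using C p by (intro exI[of _ "topspace T - C2"]) auto
      qed
      then obtain V2 where V2: "openin T V2" "p \<in> V2" "\<And>s. s \<in> V2 \<Longrightarrow> s \<in> C2 \<Longrightarrow> p \<in> C2"
        by metis
      define V3 where "V3 = topspace T - (\<Union>j\<in>F - J p. K j)"
      have "closedin T (\<Union>j\<in>F - J p. K j)" using F K by (intro closedin_Union) auto
      then have V3: "openin T V3" "p \<in> V3" using p by (auto simp: V3_def J_def)
      have J3: "J s \<subseteq> J p" if "s \<in> V3" for s using that by (auto simp: V3_def J_def)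
      have "g s \<in> min_nbhd (chain_space X) (g p)" if s: "s \<in> V1 \<inter> V2 \<inter> V3" for s
      proof -
        have "s \<in> topspace T" using s V3_def by blast
        then have "g s \<noteq> {}" using g_chain by (auto simp: finite_chains_def)
        moreover have "g s \<subseteq> g p"
          using s V1(3)[of s] V2(3)[of s] J3[of s] by (auto simp: g_def)
        ultimately show ?thesis using min_nbhd_chain_space[OF g_chain[OF p]] by blast
      qed
      then show "\<exists>V. openin T V \<and> p \<in> V \<and> (\<forall>s\<in>V. g s \<in> min_nbhd (chain_space X) (g p))"
        using V1 V2 V3 by (intro exI[of _ "V1 \<inter> V2 \<inter> V3"]) (auto simp: openin_Int)
    qed
    show "g t = a t" if "t \<in> A" for t
      using that U(2) C by (auto simp: g_def C2_def)
    show "b p \<in> min_nbhd X (chain_top X (g p))" if p: "p \<in> topspace T" for p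
    proof (cases "p \<in> C2")
      case True
      obtain j where j: "j \<in> J p" using J_ne[OF p] by blast
      then have "b j \<in> g p" using True by (auto simp: g_def)
      then have "b j \<in> min_nbhd X (chain_top X (g p))" using chain_top(2)[OF g_chain[OF p]] by blast
      moreover have "b p \<in> min_nbhd X (b j)" using Wb J_W[OF j] j J F by blast
      ultimately show ?thesis using min_nbhd_trans by metis
    next
      case False
      then have "p \<in> C1" using C p by (auto simp: C2_def)
      then have "g p = a p" "p \<in> N" using False C by (auto simp: g_def)
      then show ?thesis using ab min_nbhd_refl by metis
    qed
  qed
qed


section \<open>Weak equivalences from relative lifting\<close>

abbreviation cube_cylinder :: "nat \<Rightarrow> (real \<times> (nat \<Rightarrow> real)) topology" where
  "cube_cylinder n \<equiv> prod_topology (top_of_set {0..1}) (unit_cube n)"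

text \<open>
  A relative lifting condition up to homotopy. The prescribed partial lift \<open>a\<close> lives on a
  neighbourhood \<open>N\<close> of \<open>A\<close> and is reproduced on \<open>A\<close> only; the slack between \<open>A\<close> and \<open>N\<close> is what the
  construction of a lift uses up. Cylinders over cubes serve as test spaces for spheroids and for their
  homotopies alike.
\<close>

definition relative_lifting :: "'a topology \<Rightarrow> 'b topology \<Rightarrow> ('a \<Rightarrow> 'b) \<Rightarrow> bool" where
  "relative_lifting V W f \<longleftrightarrow>
     (\<forall>n A N a b. closedin (cube_cylinder n) A \<longrightarrow> A \<subseteq> N \<longrightarrow> openin (cube_cylinder n) N \<longrightarrow>
        continuous_map (subtopology (cube_cylinder n) N) V a \<longrightarrow>
        continuous_map (cube_cylinder n) W b \<longrightarrow> (\<forall>t\<in>N. f (a t) = b t) \<longrightarrow>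
        (\<exists>g. continuous_map (cube_cylinder n) V g \<and> (\<forall>t\<in>A. g t = a t) \<and>
             homotopic_with (\<lambda>h. \<forall>t\<in>A. h t = b t) (cube_cylinder n) W b (f \<circ> g)))"

lemma relative_liftingE:
  assumes "relative_lifting V W f" "closedin (cube_cylinder n) A" "A \<subseteq> N"
    "openin (cube_cylinder n) N" "continuous_map (subtopology (cube_cylinder n) N) V a"
    "continuous_map (cube_cylinder n) W b" "\<And>t. t \<in> N \<Longrightarrow> f (a t) = b t"
  obtains g where "continuous_map (cube_cylinder n) V g" "\<And>t. t \<in> A \<Longrightarrow> g t = a t"
    "homotopic_with (\<lambda>h. \<forall>t\<in>A. h t = b t) (cube_cylinder n) W b (f \<circ> g)"
proof -
  have "\<exists>g. continuous_map (cube_cylinder n) V g \<and> (\<forall>t\<in>A. g t = a t) \<and>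
      homotopic_with (\<lambda>h. \<forall>t\<in>A. h t = b t) (cube_cylinder n) W b (f \<circ> g)"
    by (rule assms(1)[unfolded relative_lifting_def, rule_format, OF assms(2-7)])
  then show thesis using that by (elim exE conjE) (rule, auto)
qed

lemma compact_metrizable_cube_cylinder:
  "compact_space (cube_cylinder n)" "metrizable_space (cube_cylinder n)"
proof -
  have "compact_space (top_of_set {0..1::real})" "metrizable_space (top_of_set {0..1::real})"
    by (auto simp: compact_space_subtopology metrizable_space_subtopology metrizable_space_euclidean)
  moreover have "countable {i \<in> {..<n}. P i}" for P
    by (rule countable_finite) simp
  ultimately show "compact_space (cube_cylinder n)" "metrizable_space (cube_cylinder n)"
    by (simp_all add: unit_cube_def compact_space_prod_topology metrizable_space_prod_topology
        compact_space_product_topology metrizable_space_product_topology)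
qed

lemma relative_lifting_chain_top:
  assumes X: "alexandroff_space X"
  shows "relative_lifting (chain_space X) X (chain_top X)"
  unfolding relative_lifting_def
proof (intro allI impI)
  fix n A N a b
  assume A: "closedin (cube_cylinder n) A" "A \<subseteq> N" and N: "openin (cube_cylinder n) N"
    and a: "continuous_map (subtopology (cube_cylinder n) N) (chain_space X) a"
    and b: "continuous_map (cube_cylinder n) X b" and ab: "\<forall>t\<in>N. chain_top X (a t) = b t"
  obtain g where g: "continuous_map (cube_cylinder n) (chain_space X) g" "\<And>t. t \<in> A \<Longrightarrow> g t = a t"
    "\<And>t. t \<in> topspace (cube_cylinder n) \<Longrightarrow> b t \<in> min_nbhd X (chain_top X (g t))"
    by (rule chain_lift[OF X compact_metrizable_cube_cylinder A N a b]) (use ab in auto)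
  have "homotopic_with (\<lambda>h. \<forall>t\<in>A. h t = b t) (cube_cylinder n) X b (chain_top X \<circ> g)"
  proof (rule homotopic_with_comparable[OF X b])
    show "continuous_map (cube_cylinder n) X (chain_top X \<circ> g)"
      using g(1) continuous_map_chain_top[OF X] by (rule continuous_map_compose)
    show "(chain_top X \<circ> g) t = b t" if "t \<in> A" for t
      using that g(2) ab A(2) by auto
  qed (use g(3) in simp)
  then show "\<exists>g. continuous_map (cube_cylinder n) (chain_space X) g \<and> (\<forall>t\<in>A. g t = a t) \<and>
      homotopic_with (\<lambda>h. \<forall>t\<in>A. h t = b t) (cube_cylinder n) X b (chain_top X \<circ> g)"
    using g by blast
qed

text \<open>
  The zigzag in the definition of weak homotopy equivalence of spaces runs between homeomorphic copies,
  so the lifting condition has to be moved along homeomorphisms.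
\<close>

lemma relative_lifting_homeomorphic:
  assumes f: "relative_lifting V W f" "continuous_map V W f"
    and j: "homeomorphic_maps V V' j j'" and i: "homeomorphic_maps W W' i i'"
  shows "relative_lifting V' W' (i \<circ> f \<circ> j')"
  unfolding relative_lifting_def
proof (intro allI impI)
  fix n A N a b
  assume A: "closedin (cube_cylinder n) A" "A \<subseteq> N" and N: "openin (cube_cylinder n) N"
    and a: "continuous_map (subtopology (cube_cylinder n) N) V' a"
    and b: "continuous_map (cube_cylinder n) W' b" and ab: "\<forall>t\<in>N. (i \<circ> f \<circ> j') (a t) = b t"
  have j_maps: "continuous_map V V' j" "continuous_map V' V j'" "\<And>y. y \<in> topspace V' \<Longrightarrow> j (j' y) = y"
    "\<And>y. y \<in> topspace V \<Longrightarrow> j' (j y) = y"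
    and i_maps: "continuous_map W W' i" "continuous_map W' W i'" "\<And>y. y \<in> topspace W' \<Longrightarrow> i (i' y) = y"
    "\<And>y. y \<in> topspace W \<Longrightarrow> i' (i y) = y"
    using i j by (simp_all add: homeomorphic_maps_def)
  have A_top: "A \<subseteq> topspace (cube_cylinder n)" using A(1) by (rule closedin_subset)
  have a_in: "a t \<in> topspace V'" if "t \<in> N" for t
  proof -
    have "t \<in> topspace (subtopology (cube_cylinder n) N)"
      using that openin_subset[OF N] by auto
    then show ?thesis using continuous_map_funspace[OF a] by blast
  qed
  have b_in: "b t \<in> topspace W'" if "t \<in> topspace (cube_cylinder n)" for t
    using continuous_map_funspace[OF b] that by blast
  obtain g where g: "continuous_map (cube_cylinder n) V g" "\<And>t. t \<in> A \<Longrightarrow> g t = (j' \<circ> a) t"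
    "homotopic_with (\<lambda>h. \<forall>t\<in>A. h t = (i' \<circ> b) t) (cube_cylinder n) W (i' \<circ> b) (f \<circ> g)"
  proof (rule relative_liftingE[OF f(1) A N])
    show "continuous_map (subtopology (cube_cylinder n) N) V (j' \<circ> a)"
      using a j_maps by (intro continuous_map_compose)
    show "continuous_map (cube_cylinder n) W (i' \<circ> b)"
      using b i_maps by (intro continuous_map_compose)
    show "f ((j' \<circ> a) t) = (i' \<circ> b) t" if "t \<in> N" for t
    proof -
      have "f (j' (a t)) \<in> topspace W"
        using continuous_map_funspace[OF f(2)] continuous_map_funspace[OF j_maps(2)] a_in[OF that] by blast
      then have "i' (i (f (j' (a t)))) = f (j' (a t))" by (rule i_maps)
      then show ?thesis using ab that by auto
    qed
  qed (rule that)
  have "homotopic_with (\<lambda>h. \<forall>t\<in>A. h t = b t) (cube_cylinder n) W' (i \<circ> (i' \<circ> b)) (i \<circ> (f \<circ> g))"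
    by (rule homotopic_with_compose_continuous_map_left[OF g(3) i_maps(1)])
       (use i_maps(3) b_in A_top in auto)
  then have "homotopic_with (\<lambda>h. \<forall>t\<in>A. h t = b t) (cube_cylinder n) W' b ((i \<circ> f \<circ> j') \<circ> (j \<circ> g))"
  proof (rule homotopic_with_eq)
    show "b t = (i \<circ> (i' \<circ> b)) t" if "t \<in> topspace (cube_cylinder n)" for t
      using i_maps(3) b_in[OF that] by simp
    show "((i \<circ> f \<circ> j') \<circ> (j \<circ> g)) t = (i \<circ> (f \<circ> g)) t" if "t \<in> topspace (cube_cylinder n)" for t
    proof -
      have "g t \<in> topspace V" using continuous_map_funspace[OF g(1)] that by blast
      then show ?thesis using j_maps(4) by simp
    qed
  qed (use A_top in \<open>metis subsetD\<close>)
  moreover have "continuous_map (cube_cylinder n) V' (j \<circ> g)"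
    using g(1) j_maps(1) by (rule continuous_map_compose)
  moreover have "(j \<circ> g) t = a t" if "t \<in> A" for t
    using g(2)[OF that] j_maps(3)[OF a_in, of t] that A(2) by auto
  ultimately show "\<exists>g. continuous_map (cube_cylinder n) V' g \<and> (\<forall>t\<in>A. g t = a t) \<and>
      homotopic_with (\<lambda>h. \<forall>t\<in>A. h t = b t) (cube_cylinder n) W' b ((i \<circ> f \<circ> j') \<circ> g)"
    by blast
qed

section \<open>Spheroids that are constant near the boundary\<close>

lemma topspace_unit_cube: "topspace (unit_cube n) = ({..<n} \<rightarrow>\<^sub>E {0..1})"
  by (simp add: unit_cube_def)

lemma unit_cube_coordinate:
  "t \<in> topspace (unit_cube n) \<Longrightarrow> i < n \<Longrightarrow> 0 \<le> t i \<and> t i \<le> 1"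
  by (auto simp: topspace_unit_cube PiE_iff)

lemma continuous_map_cube_coordinate:
  "i < n \<Longrightarrow> continuous_map (unit_cube n) euclideanreal (\<lambda>t. t i)"
proof -
  assume "i < n"
  then have "continuous_map (unit_cube n) (top_of_set {0..1}) (\<lambda>t. t i)"
    using continuous_map_product_projection[of i "{..<n}" "\<lambda>_. top_of_set {0..1::real}"]
    by (simp add: unit_cube_def)
  then show ?thesis by (rule continuous_map_into_fulltopology)
qed

lemma continuous_map_into_cube:
  "continuous_map T (unit_cube n) g \<longleftrightarrow>
     g ` topspace T \<subseteq> extensional {..<n} \<and>
     (\<forall>i<n. continuous_map T euclideanreal (\<lambda>t. g t i) \<and> (\<forall>t\<in>topspace T. 0 \<le> g t i \<and> g t i \<le> 1))"
  unfolding unit_cube_def continuous_map_componentwise continuous_map_in_subtopology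
  by (auto simp: Pi_iff)

lemma cube_boundary_iff:
  "t \<in> cube_boundary n \<longleftrightarrow> t \<in> topspace (unit_cube n) \<and> (\<exists>i<n. t i = 0 \<or> t i = 1)"
  by (simp add: cube_boundary_def)

text \<open>
  A map of the unit interval onto itself that is constant on \<open>{0..1/4}\<close> and on \<open>{3/4..1}\<close>.
\<close>

definition ramp :: "real \<Rightarrow> real" where
  "ramp u = max 0 (min 1 (2 * u - 1/2))"

lemma ramp_bounds: "0 \<le> ramp u" "ramp u \<le> 1"
  by (auto simp: ramp_def)

lemma ramp_eq_0: "u \<le> 1/4 \<Longrightarrow> ramp u = 0"
  by (simp add: ramp_def)

lemma ramp_eq_1: "3/4 \<le> u \<Longrightarrow> ramp u = 1"
  by (simp add: ramp_def)

lemma continuous_map_ramp: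
  assumes "continuous_map T euclideanreal u"
  shows "continuous_map T euclideanreal (\<lambda>t. ramp (u t))"
proof -
  have "continuous_on UNIV ramp"
    unfolding ramp_def by (intro continuous_intros)
  then have "continuous_map euclideanreal euclideanreal ramp" by simp
  from continuous_map_compose[OF assms this] show ?thesis by (simp add: o_def)
qed

definition cube_ramp :: "nat \<Rightarrow> (nat \<Rightarrow> real) \<Rightarrow> nat \<Rightarrow> real" where
  "cube_ramp n t = (\<lambda>i\<in>{..<n}. ramp (t i))"

lemma continuous_map_cube_ramp: "continuous_map (unit_cube n) (unit_cube n) (cube_ramp n)"
  unfolding continuous_map_into_cube
  by (auto simp: cube_ramp_def ramp_bounds continuous_map_ramp continuous_map_cube_coordinate)

lemma cube_ramp_in_cube: "cube_ramp n t \<in> topspace (unit_cube n)"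
  by (auto simp: topspace_unit_cube cube_ramp_def ramp_bounds)

definition cube_collar :: "nat \<Rightarrow> (nat \<Rightarrow> real) set" where
  "cube_collar n = {t \<in> topspace (unit_cube n). \<exists>i<n. t i < 1/4 \<or> 3/4 < t i}"

lemma cube_ramp_collar: "t \<in> cube_collar n \<Longrightarrow> cube_ramp n t \<in> cube_boundary n"
proof -
  assume "t \<in> cube_collar n"
  then obtain i where i: "i < n" "t i < 1/4 \<or> 3/4 < t i" by (auto simp: cube_collar_def)
  then have "cube_ramp n t i = 0 \<or> cube_ramp n t i = 1"
    using ramp_eq_0[of "t i"] ramp_eq_1[of "t i"] by (auto simp: cube_ramp_def)
  then show "cube_ramp n t \<in> cube_boundary n"
    using i cube_ramp_in_cube by (auto simp: cube_boundary_iff)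
qed

lemma cube_boundary_subset_collar: "cube_boundary n \<subseteq> cube_collar n"
  by (auto simp: cube_boundary_def cube_collar_def)

lemma openin_cube_collar: "openin (unit_cube n) (cube_collar n)"
proof -
  have "cube_collar n = (\<Union>i<n. {t \<in> topspace (unit_cube n). t i \<in> {..<1/4} \<union> {3/4<..}})"
    by (auto simp: cube_collar_def)
  moreover have "openin (unit_cube n) {t \<in> topspace (unit_cube n). t i \<in> {..<1/4} \<union> {3/4<..}}"
    if "i < n" for i
    by (rule openin_continuous_map_preimage[OF continuous_map_cube_coordinate[OF that]]) auto
  ultimately show ?thesis by (auto intro!: openin_Union)
qed

lemma closedin_cube_boundary: "closedin (unit_cube n) (cube_boundary n)"
proof -
  have "cube_boundary n = (\<Union>i<n. {t \<in> topspace (unit_cube n). t i \<in> {0, 1}})"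
    by (auto simp: cube_boundary_def)
  moreover have "closedin (unit_cube n) {t \<in> topspace (unit_cube n). t i \<in> {0, 1}}" if "i < n" for i
    by (rule closedin_continuous_map_preimage[OF continuous_map_cube_coordinate[OF that]]) auto
  ultimately show ?thesis by (auto intro!: closedin_Union)
qed

lemma spheroid_property_cong:
  assumes "\<And>t. t \<in> topspace (unit_cube n) \<Longrightarrow> h t = k t"
  shows "(\<forall>t\<in>cube_boundary n. h t = x) \<longleftrightarrow> (\<forall>t\<in>cube_boundary n. k t = x)"
  using assms by (auto simp: cube_boundary_def)

lemma spheroid_homotopic_iff:
  "spheroid_homotopic n X x p q \<longleftrightarrow>
     (\<exists>H. continuous_map (cube_cylinder n) X H \<and>
          (\<forall>t\<in>topspace (unit_cube n). H (0, t) = p t) \<and> (\<forall>t\<in>topspace (unit_cube n). H (1, t) = q t) \<and>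
          (\<forall>s\<in>{0..1}. \<forall>t\<in>cube_boundary n. H (s, t) = x))"
  unfolding spheroid_homotopic_def
  by (rule homotopic_with) (rule spheroid_property_cong)

text \<open>
  The straight-line homotopy from the identity to \<open>ramp\<close> fixes \<open>0\<close> and \<open>1\<close>. Applied to each coordinate
  it therefore maps every face of the cube into itself, so it induces a homotopy of spheroids. After it,
  a spheroid is constant on a whole collar of the boundary, as \<open>relative_lifting\<close> demands.
\<close>

lemma spheroid_homotopic_ramp:
  assumes g: "g \<in> spheroids n X x"
  shows "spheroid_homotopic n X x g (g \<circ> cube_ramp n)"
  unfolding spheroid_homotopic_iff
proof (intro exI conjI ballI)
  let ?c = "\<lambda>(s, t). \<lambda>i\<in>{..<n}. (1 - s) * t i + s * ramp (t i)"
  have "continuous_map (cube_cylinder n) (unit_cube n) ?c"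
    unfolding continuous_map_into_cube
  proof (intro conjI allI impI ballI)
    show "?c ` topspace (cube_cylinder n) \<subseteq> extensional {..<n}" by auto
    fix i assume i: "i < n"
    have s: "continuous_map (cube_cylinder n) euclideanreal fst"
      by (rule continuous_map_into_fulltopology[OF continuous_map_fst])
    have t: "continuous_map (cube_cylinder n) euclideanreal (\<lambda>p. snd p i)"
      using continuous_map_compose[OF continuous_map_snd continuous_map_cube_coordinate[OF i]]
      by (simp add: o_def)
    have "continuous_map (cube_cylinder n) euclideanreal
        (\<lambda>p. (1 - fst p) * snd p i + fst p * ramp (snd p i))"
      by (intro continuous_map_add continuous_map_real_mult continuous_map_diff s t continuous_map_ramp) simp
    then show "continuous_map (cube_cylinder n) euclideanreal (\<lambda>p. ?c p i)"
      using i by (simp add: case_prod_beta')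
    fix p assume "p \<in> topspace (cube_cylinder n)"
    then obtain s t where p: "p = (s, t)" "0 \<le> s" "s \<le> 1" "t \<in> topspace (unit_cube n)" by auto
    have "(1 - s) * t i + s * ramp (t i) \<le> 1"
      using p unit_cube_coordinate[OF p(4) i] ramp_bounds by (intro convex_bound_le) auto
    then show "0 \<le> ?c p i" "?c p i \<le> 1"
      using i p unit_cube_coordinate[OF p(4) i] ramp_bounds by auto
  qed
  moreover have "continuous_map (unit_cube n) X g" using g by (simp add: spheroids_def)
  ultimately show "continuous_map (cube_cylinder n) X (g \<circ> ?c)" by (rule continuous_map_compose)
  show "(g \<circ> ?c) (0, t) = g t" if "t \<in> topspace (unit_cube n)" for t
  proof -
    have "restrict t {..<n} = t" using that by (simp add: topspace_unit_cube PiE_restrict)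
    then show ?thesis by simp
  qed
  show "(g \<circ> ?c) (1, t) = (g \<circ> cube_ramp n) t" if "t \<in> topspace (unit_cube n)" for t
    by (simp add: cube_ramp_def)
  fix s t assume s: "s \<in> {0..1::real}" and t: "t \<in> cube_boundary n"
  then obtain i where i: "i < n" "t i = 0 \<or> t i = 1" and tc: "t \<in> topspace (unit_cube n)"
    by (auto simp: cube_boundary_def)
  have "?c (s, t) i = 0 \<or> ?c (s, t) i = 1"
    using i by (auto simp: ramp_eq_0 ramp_eq_1)
  moreover have "?c (s, t) \<in> topspace (unit_cube n)"
  proof -
    have "(s, t) \<in> topspace (cube_cylinder n)" using s tc by simp
    then show ?thesis
      using continuous_map_funspace[OF \<open>continuous_map (cube_cylinder n) (unit_cube n) ?c\<close>] by blast
  qed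
  ultimately have "?c (s, t) \<in> cube_boundary n" using i(1) unfolding cube_boundary_iff by blast
  then show "(g \<circ> ?c) (s, t) = x" using g by (simp add: spheroids_def)
qed


lemma spheroid_homotopic_sym: "spheroid_homotopic n X x g h \<Longrightarrow> spheroid_homotopic n X x h g"
  unfolding spheroid_homotopic_def by (rule homotopic_with_symD)

lemma spheroid_homotopic_trans:
  "spheroid_homotopic n X x g h \<Longrightarrow> spheroid_homotopic n X x h k \<Longrightarrow> spheroid_homotopic n X x g k"
  unfolding spheroid_homotopic_def by (rule homotopic_with_trans)

lemma spheroid_homotopic_refl: "spheroid_homotopic n X x g g \<longleftrightarrow> g \<in> spheroids n X x"
  unfolding spheroid_homotopic_def spheroids_def by simp

lemma spheroid_homotopic_compose:
  assumes "continuous_map X Y f" "spheroid_homotopic n X x g h"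
  shows "spheroid_homotopic n Y (f x) (f \<circ> g) (f \<circ> h)"
  using assms(2) unfolding spheroid_homotopic_def
  by (rule homotopic_with_compose_continuous_map_left[OF _ assms(1)]) simp

lemma spheroids_compose:
  assumes "continuous_map X Y f" "g \<in> spheroids n X x"
  shows "f \<circ> g \<in> spheroids n Y (f x)"
  using spheroid_homotopic_compose[OF assms(1)] assms(2) spheroid_homotopic_refl by metis

lemma continuous_map_cylinder_slice:
  "s \<in> {0..1} \<Longrightarrow> continuous_map (unit_cube n) (cube_cylinder n) (\<lambda>t. (s, t))"
  by (simp add: continuous_map_pairwise o_def)

text \<open>
  Surjectivity on homotopy groups. The spheroid is pulled back to the cylinder, lifted there with the
  constant lift \<open>y\<close> prescribed near the boundary, and restricted to the bottom of the cylinder.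
\<close>

lemma relative_lifting_spheroid:
  assumes f: "relative_lifting V W f" and y: "y \<in> topspace V" and b: "b \<in> spheroids n W (f y)"
  obtains g where "g \<in> spheroids n V y" "spheroid_homotopic n W (f y) b (f \<circ> g)"
proof -
  define A where "A = {0..1::real} \<times> cube_boundary n"
  define N where "N = {0..1::real} \<times> cube_collar n"
  define b' where "b' = (b \<circ> cube_ramp n) \<circ> (snd :: real \<times> (nat \<Rightarrow> real) \<Rightarrow> _)"
  have A: "closedin (cube_cylinder n) A"
    unfolding A_def by (simp add: closedin_prod_Times_iff closedin_cube_boundary)
  have AN: "A \<subseteq> N" using cube_boundary_subset_collar by (auto simp: A_def N_def)
  have N: "openin (cube_cylinder n) N"
    unfolding N_def by (simp add: openin_prod_Times_iff openin_cube_collar)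
  have a: "continuous_map (subtopology (cube_cylinder n) N) V (\<lambda>_. y)" using y by simp
  have "continuous_map (unit_cube n) W b" using b by (simp add: spheroids_def)
  then have b': "continuous_map (cube_cylinder n) W b'"
    unfolding b'_def
    by (intro continuous_map_compose[OF continuous_map_snd] continuous_map_compose[OF continuous_map_cube_ramp])
  have b'_y: "b' p = f y" if "p \<in> N" for p
    using that b cube_ramp_collar by (auto simp: b'_def N_def spheroids_def)
  have "f ((\<lambda>_. y) p) = b' p" if "p \<in> N" for p
    using b'_y[OF that] by simp
  from relative_liftingE[OF f A AN N a b' this]
  obtain g where g: "continuous_map (cube_cylinder n) V g" "\<And>t. t \<in> A \<Longrightarrow> g t = y"
    and bg: "homotopic_with (\<lambda>h. \<forall>t\<in>A. h t = b' t) (cube_cylinder n) W b' (f \<circ> g)"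
    by blast
  have "homotopic_with (\<lambda>h. \<forall>t\<in>cube_boundary n. h t = f y) (unit_cube n) W
      (b' \<circ> Pair 0) ((f \<circ> g) \<circ> Pair 0)"
  proof (rule homotopic_with_compose_continuous_map_right[OF bg])
    show "continuous_map (unit_cube n) (cube_cylinder n) (Pair 0)"
      using continuous_map_cylinder_slice[of 0 n] by simp
    show "\<forall>t\<in>cube_boundary n. (j \<circ> Pair 0) t = f y" if "\<forall>t\<in>A. j t = b' t" for j
    proof
      fix t assume "t \<in> cube_boundary n"
      then have "(0, t) \<in> A" by (simp add: A_def)
      then show "(j \<circ> Pair 0) t = f y" using that b'_y[of "(0, t)"] AN by auto
    qed
  qed
  then have "spheroid_homotopic n W (f y) (b \<circ> cube_ramp n) (f \<circ> (g \<circ> Pair 0))"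
    by (simp add: spheroid_homotopic_def b'_def o_def)
  then have "spheroid_homotopic n W (f y) b (f \<circ> (g \<circ> Pair 0))"
    using spheroid_homotopic_trans[OF spheroid_homotopic_ramp[OF b]] by blast
  moreover have "continuous_map (unit_cube n) V (g \<circ> Pair 0)"
    using continuous_map_compose[OF continuous_map_cylinder_slice[of 0 n] g(1)] by (simp add: o_def)
  then have "g \<circ> Pair 0 \<in> spheroids n V y"
    using g(2) by (auto simp: spheroids_def A_def)
  ultimately show thesis using that by blast
qed

text \<open>
  Injectivity on homotopy groups. A homotopy between \<open>f \<circ> g\<close> and \<open>f \<circ> h\<close> is stretched in time as
  well as in space, so that near the two ends it is \<open>f \<circ> g\<close> and \<open>f \<circ> h\<close> and near the lateral boundary it
  is constant. There the lifts \<open>g\<close>, \<open>h\<close> and \<open>y\<close> are at hand, and the lifting condition extends them to a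
  homotopy between \<open>g\<close> and \<open>h\<close>. In dimension \<open>0\<close> this is the statement that \<open>f\<close> is injective
  on path components.
\<close>

lemma relative_lifting_spheroid_homotopy:
  assumes f: "relative_lifting V W f" and y: "y \<in> topspace V"
    and g: "g \<in> spheroids n V y" and h: "h \<in> spheroids n V y"
    and fgh: "spheroid_homotopic n W (f y) (f \<circ> g) (f \<circ> h)"
  shows "spheroid_homotopic n V y g h"
proof -
  obtain H where H: "continuous_map (cube_cylinder n) W H"
    "\<And>t. t \<in> topspace (unit_cube n) \<Longrightarrow> H (0, t) = f (g t)"
    "\<And>t. t \<in> topspace (unit_cube n) \<Longrightarrow> H (1, t) = f (h t)"
    "\<And>s t. s \<in> {0..1} \<Longrightarrow> t \<in> cube_boundary n \<Longrightarrow> H (s, t) = f y"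
    using fgh unfolding spheroid_homotopic_iff by auto
  have g': "continuous_map (unit_cube n) V g" "\<And>t. t \<in> cube_boundary n \<Longrightarrow> g t = y"
    and h': "continuous_map (unit_cube n) V h" "\<And>t. t \<in> cube_boundary n \<Longrightarrow> h t = y"
    using g h by (auto simp: spheroids_def)
  let ?Q = "topspace (unit_cube n)"
  define A where "A = {0, 1::real} \<times> ?Q \<union> {0..1} \<times> cube_boundary n"
  \<comment> \<open>three open pieces of a neighbourhood of \<open>A\<close> (bottom, top and lateral collar) and the lifts on them\<close>
  define M where "M i = (if i = 0 then {0..<1/4} \<times> ?Q else if i = 1 then {3/4<..1} \<times> ?Q
      else {0..1::real} \<times> cube_collar n)" for i :: nat
  define m where "m i p = (if i = 0 then g (cube_ramp n (snd p)) else if i = 1 then h (cube_ramp n (snd p))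
      else y)" for i :: nat and p :: "real \<times> (nat \<Rightarrow> real)"
  define N where "N = (\<Union>i\<in>{0,1,2}. M i)"
  define a where "a p = (if fst p < 1/4 then g (cube_ramp n (snd p))
      else if 3/4 < fst p then h (cube_ramp n (snd p)) else y)" for p :: "real \<times> (nat \<Rightarrow> real)"
  define b where "b p = H (ramp (fst p), cube_ramp n (snd p))" for p :: "real \<times> (nat \<Rightarrow> real)"
  have collar_Q: "cube_collar n \<subseteq> ?Q" by (auto simp: cube_collar_def)
  have bdry_Q: "cube_boundary n \<subseteq> ?Q" by (auto simp: cube_boundary_def)
  have "closedin (top_of_set {0..1}) {0, 1::real}"
    by (intro closed_subset) auto
  then have A: "closedin (cube_cylinder n) A"
    unfolding A_def
    by (intro closedin_Un) (simp_all add: closedin_prod_Times_iff closedin_cube_boundary)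
  have AN: "A \<subseteq> N"
    using cube_boundary_subset_collar by (auto simp: A_def N_def M_def)
  have "openin (top_of_set {0..1}) {0..<1/4::real}" "openin (top_of_set {0..1}) {3/4<..1::real}"
  proof -
    have "{0..<1/4::real} = {0..1} \<inter> {..<1/4}" "{3/4<..1::real} = {0..1} \<inter> {3/4<..}" by auto
    then show "openin (top_of_set {0..1}) {0..<1/4::real}" "openin (top_of_set {0..1}) {3/4<..1::real}"
      by (auto simp: openin_open_Int)
  qed
  then have M: "openin (cube_cylinder n) (M i)" for i
    by (simp add: M_def openin_prod_Times_iff openin_cube_collar)
  then have N: "openin (cube_cylinder n) N" unfolding N_def by (intro openin_Union) blast
  have NQ: "N \<subseteq> {0..1} \<times> ?Q" using openin_subset[OF N] by simp
  have a_m: "a p = m i p" if "i \<in> {0,1,2}" "p \<in> M i" for i p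
    using that cube_ramp_collar g'(2) h'(2) by (auto simp: a_def m_def M_def split: if_splits)
  have m: "continuous_map (cube_cylinder n) V (m i)" for i
  proof -
    have "continuous_map (cube_cylinder n) (unit_cube n) (cube_ramp n \<circ> snd)"
      by (rule continuous_map_compose[OF continuous_map_snd continuous_map_cube_ramp])
    from continuous_map_compose[OF this g'(1)] continuous_map_compose[OF this h'(1)]
    show ?thesis using y by (simp add: m_def[abs_def] o_def)
  qed
  have a: "continuous_map (subtopology (cube_cylinder n) N) V a"
  proof (rule pasting_lemma[where I = "{0,1,2}" and T = M and f = m])
    have "M i \<subseteq> N" if "i \<in> {0,1,2}" for i using that by (auto simp: N_def)
    then show "openin (subtopology (cube_cylinder n) N) (M i)" if "i \<in> {0,1,2}" for i
      using M[of i] that openin_open_subtopology[OF N] by blast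
    show "continuous_map (subtopology (subtopology (cube_cylinder n) N) (M i)) V (m i)" for i
      using m by (intro continuous_map_from_subtopology)
    show "m i p = m j p"
      if "i \<in> {0,1,2}" "j \<in> {0,1,2}" "p \<in> topspace (subtopology (cube_cylinder n) N) \<inter> M i \<inter> M j" for i j p
      using that a_m[of i p] a_m[of j p] by auto
    show "\<exists>j. j \<in> {0,1,2} \<and> p \<in> M j \<and> a p = m j p"
      if "p \<in> topspace (subtopology (cube_cylinder n) N)" for p
      using that a_m[of _ p] by (auto simp: N_def)
  qed
  have "continuous_map (cube_cylinder n) (cube_cylinder n) (\<lambda>p. (ramp (fst p), cube_ramp n (snd p)))"
  proof -
    have "continuous_map (cube_cylinder n) euclideanreal fst"
      by (rule continuous_map_into_fulltopology[OF continuous_map_fst])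
    then have "continuous_map (cube_cylinder n) euclideanreal (\<lambda>p. ramp (fst p))"
      by (rule continuous_map_ramp)
    moreover have "continuous_map (cube_cylinder n) (unit_cube n) (cube_ramp n \<circ> snd)"
      by (rule continuous_map_compose[OF continuous_map_snd continuous_map_cube_ramp])
    ultimately show ?thesis
      by (simp add: continuous_map_pairwise o_def continuous_map_in_subtopology ramp_bounds)
  qed
  from continuous_map_compose[OF this H(1)]
  have b: "continuous_map (cube_cylinder n) W b" by (simp add: b_def[abs_def] o_def)
  have ab: "f (a p) = b p" if p: "p \<in> N" for p
  proof -
    have Q: "snd p \<in> ?Q" using p NQ by auto
    consider "p \<in> M 0" | "p \<in> M 1" | "p \<in> M 2" using p by (auto simp: N_def)
    then show ?thesis
    proof cases
      case 1
      then have "ramp (fst p) = 0" by (auto simp: M_def ramp_eq_0)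
      then show ?thesis using 1 a_m[of 0 p] H(2)[OF cube_ramp_in_cube] by (simp add: m_def b_def)
    next
      case 2
      then have "ramp (fst p) = 1" by (auto simp: M_def ramp_eq_1)
      then show ?thesis using 2 a_m[of 1 p] H(3)[OF cube_ramp_in_cube] by (simp add: m_def b_def)
    next
      case 3
      then have "cube_ramp n (snd p) \<in> cube_boundary n" by (auto simp: M_def cube_ramp_collar)
      then show ?thesis using 3 a_m[of 2 p] H(4) ramp_bounds by (simp add: m_def b_def)
    qed
  qed
  from relative_liftingE[OF f A AN N a b ab]
  obtain G where G: "continuous_map (cube_cylinder n) V G" "\<And>p. p \<in> A \<Longrightarrow> G p = a p"
    by blast
  have "spheroid_homotopic n V y (g \<circ> cube_ramp n) (h \<circ> cube_ramp n)"
    unfolding spheroid_homotopic_iff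
  proof (intro exI conjI ballI)
    show "continuous_map (cube_cylinder n) V G" by (rule G)
    show "G (0, t) = (g \<circ> cube_ramp n) t" if "t \<in> ?Q" for t
      using that G(2) by (simp add: A_def a_def)
    show "G (1, t) = (h \<circ> cube_ramp n) t" if "t \<in> ?Q" for t
      using that G(2) by (simp add: A_def a_def)
    show "G (s, t) = y" if "s \<in> {0..1}" "t \<in> cube_boundary n" for s t
    proof -
      have "(s, t) \<in> M 2" using that cube_boundary_subset_collar by (auto simp: M_def)
      then have "a (s, t) = y" using a_m[of 2 "(s, t)"] by (simp add: m_def)
      then show ?thesis using that G(2) by (simp add: A_def)
    qed
  qed
  then show ?thesis
    using spheroid_homotopic_ramp[OF g] spheroid_homotopic_ramp[OF h]
    by (meson spheroid_homotopic_trans spheroid_homotopic_sym)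
qed


section \<open>Path components\<close>

lemma path_component_of_continuous_image:
  "continuous_map V W f \<Longrightarrow> path_component_of V x y \<Longrightarrow> path_component_of W (f x) (f y)"
  unfolding path_component_of_def using pathin_compose by fastforce

lemma path_components_induced_component:
  assumes "continuous_map V W f" "v \<in> topspace V"
  shows "path_components_induced W f (path_component_of_set V v) = path_component_of_set W (f v)"
proof -
  have "path_component_of_set W (f x) = path_component_of_set W (f v)" if "path_component_of V v x" for x
    using path_component_of_continuous_image[OF assms(1) that] path_component_of_equiv by metis
  moreover have "v \<in> path_component_of_set V v" using assms(2) by (simp add: path_component_of_refl)
  ultimately show ?thesis unfolding path_components_induced_def by blast
qed

text \<open>
  The \<open>0\<close>-cube is a point, so injectivity is the lifting of homotopies between \<open>0\<close>-spheroids, and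
  surjectivity is the lifting of a constant map with no prescribed values.
\<close>

lemma relative_lifting_path_components:
  assumes f: "relative_lifting V W f" "continuous_map V W f"
  shows "bij_betw (path_components_induced W f) (path_components_of V) (path_components_of W)"
  unfolding bij_betw_def
proof (intro conjI subset_antisym subsetI)
  \<comment> \<open>the only point of the \<open>0\<close>-cube\<close>
  define pt where "pt = (\<lambda>_::nat. undefined :: real)"
  have pt: "topspace (unit_cube 0) = {pt}" by (auto simp: topspace_unit_cube pt_def)
  then have nontriv: "unit_cube 0 \<noteq> trivial_topology" "cube_cylinder 0 \<noteq> trivial_topology"
    by (force simp flip: null_topspace_iff_trivial)+
  have bdry: "cube_boundary 0 = {}" by (simp add: cube_boundary_def)
  show "inj_on (path_components_induced W f) (path_components_of V)"
    unfolding path_components_of_def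
  proof (intro inj_onI, elim imageE)
    fix C D v v' assume CD: "C = path_component_of_set V v" "D = path_component_of_set V v'"
      and v: "v \<in> topspace V" "v' \<in> topspace V"
      and eq: "path_components_induced W f C = path_components_induced W f D"
    have "f v \<in> topspace W" using continuous_map_funspace[OF f(2)] v by blast
    moreover have "f v' \<in> topspace W" using continuous_map_funspace[OF f(2)] v by blast
    ultimately have "path_component_of W (f v) (f v')"
      using eq v by (simp add: CD path_components_induced_component[OF f(2)] path_component_of_refl set_eq_iff)
    then have "spheroid_homotopic 0 W (f v) (f \<circ> (\<lambda>_. v)) (f \<circ> (\<lambda>_. v'))"
      using nontriv by (simp add: spheroid_homotopic_def bdry o_def homotopic_constant_maps)
    then have "spheroid_homotopic 0 V v (\<lambda>_. v) (\<lambda>_. v')"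
      by (rule relative_lifting_spheroid_homotopy[OF f(1) v(1), rotated 2])
         (use v in \<open>auto simp: spheroids_def bdry\<close>)
    then have "path_component_of V v v'"
      using nontriv by (simp add: spheroid_homotopic_def bdry homotopic_constant_maps)
    then show "C = D" unfolding CD using path_component_of_equiv by metis
  qed
  show "D \<in> path_components_of W" if "D \<in> path_components_induced W f ` path_components_of V" for D
    using that path_components_induced_component[OF f(2)] continuous_map_funspace[OF f(2)]
    by (auto simp: path_components_of_def)
  fix D assume "D \<in> path_components_of W"
  then obtain w where w: "w \<in> topspace W" "D = path_component_of_set W w"
    by (auto simp: path_components_of_def)
  obtain g where g: "continuous_map (cube_cylinder 0) V g"
    and wg: "homotopic_with (\<lambda>h. \<forall>t\<in>{}. h t = w) (cube_cylinder 0) W (\<lambda>_. w) (f \<circ> g)"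
    by (rule relative_liftingE[OF f(1), of 0 "{}" "{}" undefined "\<lambda>_. w"]) (use w in auto)
  let ?p = "(0::real, pt)"
  have p: "?p \<in> topspace (cube_cylinder 0)" by (simp add: pt)
  then have gp: "g ?p \<in> topspace V" using continuous_map_funspace[OF g] by blast
  have "homotopic_with (\<lambda>_. True) (cube_cylinder 0) W ((\<lambda>_. w) \<circ> (\<lambda>_. ?p)) ((f \<circ> g) \<circ> (\<lambda>_. ?p))"
    by (rule homotopic_with_compose_continuous_map_right[OF wg]) (use p in auto)
  then have "path_component_of W w (f (g ?p))"
    using nontriv(2) by (simp add: o_def[abs_def] homotopic_constant_maps)
  then have "D = path_component_of_set W (f (g ?p))"
    unfolding w using path_component_of_equiv by metis
  then show "D \<in> path_components_induced W f ` path_components_of V"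
    using path_components_induced_component[OF f(2) gp] gp unfolding path_components_of_def by blast
qed

section \<open>Homotopy groups\<close>

lemma spheroid_class_eq: "spheroid_homotopic n X x g h \<Longrightarrow> spheroid_class n X x g = spheroid_class n X x h"
  unfolding spheroid_class_def
  by (rule Collect_cong) (meson spheroid_homotopic_sym spheroid_homotopic_trans)

lemma spheroid_class_eq_iff:
  assumes "h \<in> spheroids n X x"
  shows "spheroid_class n X x g = spheroid_class n X x h \<longleftrightarrow> spheroid_homotopic n X x g h"
proof
  assume eq: "spheroid_class n X x g = spheroid_class n X x h"
  have "h \<in> spheroid_class n X x h"
    using assms by (simp add: spheroid_class_def spheroid_homotopic_refl)
  then have "h \<in> spheroid_class n X x g" by (simp only: eq)
  then show "spheroid_homotopic n X x g h" by (simp add: spheroid_class_def)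
qed (rule spheroid_class_eq)

lemma homotopy_group_induced_class:
  assumes f: "continuous_map X Y f" and g: "g \<in> spheroids n X x"
  shows "homotopy_group_induced n Y f x (spheroid_class n X x g) = spheroid_class n Y (f x) (f \<circ> g)"
proof -
  have "spheroid_class n Y (f x) (f \<circ> h) = spheroid_class n Y (f x) (f \<circ> g)"
    if "h \<in> spheroid_class n X x g" for h
    using that spheroid_homotopic_compose[OF f] spheroid_class_eq
    by (metis mem_Collect_eq spheroid_class_def)
  moreover have "g \<in> spheroid_class n X x g"
    using g by (simp add: spheroid_class_def spheroid_homotopic_refl)
  ultimately show ?thesis
    unfolding homotopy_group_induced_def by (intro UN_constant_eq[where a = g] ballI)
qed

lemma compose_spheroid_concat: "f \<circ> spheroid_concat g h = spheroid_concat (f \<circ> g) (f \<circ> h)"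
  by (auto simp: spheroid_concat_def)

text \<open>
  The two homotopies are concatenated at each time. They agree on the wall where the first coordinate
  is \<open>1/2\<close>, because both arguments are then boundary points.
\<close>

lemma spheroid_homotopic_concat:
  assumes n: "n \<ge> 1" and g: "spheroid_homotopic n X x g g'" and h: "spheroid_homotopic n X x h h'"
  shows "spheroid_homotopic n X x (spheroid_concat g h) (spheroid_concat g' h')"
proof -
  let ?Q = "topspace (unit_cube n)"
  obtain G where G: "continuous_map (cube_cylinder n) X G"
    "\<And>t. t \<in> ?Q \<Longrightarrow> G (0, t) = g t" "\<And>t. t \<in> ?Q \<Longrightarrow> G (1, t) = g' t"
    "\<And>s t. 0 \<le> s \<Longrightarrow> s \<le> 1 \<Longrightarrow> t \<in> cube_boundary n \<Longrightarrow> G (s, t) = x"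
    using g unfolding spheroid_homotopic_iff by auto
  obtain H where H: "continuous_map (cube_cylinder n) X H"
    "\<And>t. t \<in> ?Q \<Longrightarrow> H (0, t) = h t" "\<And>t. t \<in> ?Q \<Longrightarrow> H (1, t) = h' t"
    "\<And>s t. 0 \<le> s \<Longrightarrow> s \<le> 1 \<Longrightarrow> t \<in> cube_boundary n \<Longrightarrow> H (s, t) = x"
    using h unfolding spheroid_homotopic_iff by auto
  define l where "l t = t(0 := 2 * t 0)" for t :: "nat \<Rightarrow> real"
  define r where "r t = t(0 := 2 * t 0 - 1)" for t :: "nat \<Rightarrow> real"
  define K where "K p = (if snd p 0 \<le> 1/2 then G (fst p, l (snd p)) else H (fst p, r (snd p)))"
    for p :: "real \<times> (nat \<Rightarrow> real)"
  have upd_Q: "t(0 := u) \<in> ?Q" if "t \<in> ?Q" "0 \<le> u" "u \<le> 1" for t u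
    using that n by (auto simp: topspace_unit_cube PiE_iff extensional_def)
  have l_Q: "l t \<in> ?Q" if "t \<in> ?Q" "t 0 \<le> 1/2" for t
    using that n unit_cube_coordinate[of t n 0] by (auto simp: l_def intro: upd_Q)
  have r_Q: "r t \<in> ?Q" if "t \<in> ?Q" "t 0 \<ge> 1/2" for t
    using that n unit_cube_coordinate[of t n 0] by (auto simp: r_def intro: upd_Q)
  have coord: "continuous_map (cube_cylinder n) euclideanreal (\<lambda>p. snd p i)" if "i < n" for i
    using continuous_map_compose[OF continuous_map_snd continuous_map_cube_coordinate[OF that]]
    by (simp add: o_def)
  \<comment> \<open>the cases \<open>c = 0\<close> and \<open>c = 1\<close> are the stretchings \<open>l\<close> and \<open>r\<close> of the two halves\<close>
  have upd: "continuous_map (subtopology (cube_cylinder n) S) (cube_cylinder n)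
      (\<lambda>p. (fst p, (snd p)(0 := 2 * snd p 0 - c)))"
    if S: "\<And>p. p \<in> topspace (cube_cylinder n) \<Longrightarrow> p \<in> S \<Longrightarrow> (snd p)(0 := 2 * snd p 0 - c) \<in> ?Q" for S c
  proof -
    have "continuous_map (subtopology (cube_cylinder n) S) (unit_cube n) (\<lambda>p. (snd p)(0 := 2 * snd p 0 - c))"
      unfolding continuous_map_into_cube
    proof (intro conjI allI impI ballI)
      show "(\<lambda>p. (snd p)(0 := 2 * snd p 0 - c)) ` topspace (subtopology (cube_cylinder n) S) \<subseteq> extensional {..<n}"
        using S by (fastforce simp: topspace_unit_cube PiE_iff)
      fix i assume i: "i < n"
      have "continuous_map (cube_cylinder n) euclideanreal (\<lambda>p. 2 * snd p 0 - c)"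
        using n by (intro continuous_map_diff continuous_map_real_mult_left coord) auto
      then have "continuous_map (cube_cylinder n) euclideanreal (\<lambda>p. ((snd p)(0 := 2 * snd p 0 - c)) i)"
        using coord[OF i] by (cases "i = 0") auto
      then show "continuous_map (subtopology (cube_cylinder n) S) euclideanreal
          (\<lambda>p. ((snd p)(0 := 2 * snd p 0 - c)) i)"
        by (rule continuous_map_from_subtopology)
      show "0 \<le> ((snd p)(0 := 2 * snd p 0 - c)) i" "((snd p)(0 := 2 * snd p 0 - c)) i \<le> 1"
        if "p \<in> topspace (subtopology (cube_cylinder n) S)" for p
        using unit_cube_coordinate[OF S i, of p] that by auto
    qed
    then show ?thesis
      by (simp add: continuous_map_pairwise o_def continuous_map_from_subtopology continuous_map_fst)
  qed
  have "continuous_map (cube_cylinder n) X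
      (\<lambda>p. if snd p 0 \<le> 1/2 then (\<lambda>p. G (fst p, l (snd p))) p else (\<lambda>p. H (fst p, r (snd p))) p)"
  proof (rule continuous_map_cases_le)
    show "continuous_map (cube_cylinder n) euclideanreal (\<lambda>p. snd p 0)" using n by (intro coord) auto
    show "continuous_map (cube_cylinder n) euclideanreal (\<lambda>p. 1/2)" by simp
    let ?L = "{p \<in> topspace (cube_cylinder n). snd p 0 \<le> 1/2}"
    let ?R = "{p \<in> topspace (cube_cylinder n). 1/2 \<le> snd p 0}"
    have "continuous_map (subtopology (cube_cylinder n) ?L) (cube_cylinder n) (\<lambda>p. (fst p, l (snd p)))"
      using upd[of ?L 0] l_Q by (auto simp: l_def)
    from continuous_map_compose[OF this G(1)]
    show "continuous_map (subtopology (cube_cylinder n) ?L) X (\<lambda>p. G (fst p, l (snd p)))"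
      by (simp add: o_def)
    have "continuous_map (subtopology (cube_cylinder n) ?R) (cube_cylinder n) (\<lambda>p. (fst p, r (snd p)))"
      using upd[of ?R 1] r_Q by (auto simp: r_def)
    from continuous_map_compose[OF this H(1)]
    show "continuous_map (subtopology (cube_cylinder n) ?R) X (\<lambda>p. H (fst p, r (snd p)))"
      by (simp add: o_def)
    fix p assume p: "p \<in> topspace (cube_cylinder n)" "snd p 0 = 1/2"
    then have "l (snd p) \<in> cube_boundary n" "r (snd p) \<in> cube_boundary n"
      using l_Q[of "snd p"] r_Q[of "snd p"] n unfolding cube_boundary_iff
      by (auto simp: l_def r_def intro!: exI[of _ 0])
    then show "G (fst p, l (snd p)) = H (fst p, r (snd p))"
      using p G(4) H(4) by (cases p) auto
  qed
  then have K: "continuous_map (cube_cylinder n) X K" by (simp add: K_def[abs_def])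
  show ?thesis
    unfolding spheroid_homotopic_iff
  proof (intro exI[of _ K] conjI ballI K)
    show "K (0, t) = spheroid_concat g h t" if "t \<in> ?Q" for t
      using l_Q[OF that] r_Q[OF that] G(2) H(2) by (auto simp: K_def spheroid_concat_def l_def r_def)
    show "K (1, t) = spheroid_concat g' h' t" if "t \<in> ?Q" for t
      using l_Q[OF that] r_Q[OF that] G(3) H(3) by (auto simp: K_def spheroid_concat_def l_def r_def)
    fix s t assume s: "s \<in> {0..1::real}" and t: "t \<in> cube_boundary n"
    then obtain i where i: "i < n" "t i = 0 \<or> t i = 1" and tQ: "t \<in> ?Q"
      by (auto simp: cube_boundary_def)
    show "K (s, t) = x"
    proof (cases "t 0 \<le> 1/2")
      case True
      then have "l t i = 0 \<or> l t i = 1" using i by (auto simp: l_def)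
      then have "l t \<in> cube_boundary n" using l_Q[OF tQ True] i unfolding cube_boundary_iff by blast
      then show ?thesis using True s G(4) by (simp add: K_def)
    next
      case False
      then have "r t i = 0 \<or> r t i = 1" using i by (auto simp: r_def)
      then have "r t \<in> cube_boundary n" using r_Q[OF tQ] False i unfolding cube_boundary_iff by auto
      then show ?thesis using False s H(4) by (simp add: K_def)
    qed
  qed
qed

lemma mult_homotopy_group:
  assumes n: "n \<ge> 1" and g: "g \<in> spheroids n X x" and h: "h \<in> spheroids n X x"
  shows "mult (homotopy_group n X x) (spheroid_class n X x g) (spheroid_class n X x h) =
    spheroid_class n X x (spheroid_concat g h)"
proof -
  have eq: "spheroid_class n X x (spheroid_concat g' h') = spheroid_class n X x (spheroid_concat g h)"
    if "g' \<in> spheroid_class n X x g" "h' \<in> spheroid_class n X x h" for g' h'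
    using spheroid_class_eq[OF spheroid_homotopic_concat[OF n, of X x g g' h h']] that
    by (simp add: spheroid_class_def)
  have "g \<in> spheroid_class n X x g" "h \<in> spheroid_class n X x h"
    using g h by (simp_all add: spheroid_class_def spheroid_homotopic_refl)
  then have "(\<Union>g'\<in>spheroid_class n X x g. \<Union>h'\<in>spheroid_class n X x h.
      spheroid_class n X x (spheroid_concat g' h')) = spheroid_class n X x (spheroid_concat g h)"
    by (intro UN_constant_eq[where a = g] UN_constant_eq[where a = h] ballI eq)
  then show ?thesis by (simp add: homotopy_group_def)
qed

lemma relative_lifting_homotopy_group_iso:
  assumes f: "relative_lifting V W f" "continuous_map V W f" and n: "n \<ge> 1" and y: "y \<in> topspace V"
  shows "homotopy_group_induced n W f y \<in> iso (homotopy_group n V y) (homotopy_group n W (f y))"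
proof -
  let ?i = "homotopy_group_induced n W f y"
  let ?V = "homotopy_group n V y" and ?W = "homotopy_group n W (f y)"
  have cV: "carrier ?V = spheroid_class n V y ` spheroids n V y"
    and cW: "carrier ?W = spheroid_class n W (f y) ` spheroids n W (f y)"
    by (simp_all add: homotopy_group_def)
  note ind = homotopy_group_induced_class[OF f(2)]
  note comp = spheroids_compose[OF f(2)]
  have concat: "spheroid_concat g h \<in> spheroids n V y"
    if "g \<in> spheroids n V y" "h \<in> spheroids n V y" for g h
    using spheroid_homotopic_concat[OF n, of V y g g h h] that by (simp add: spheroid_homotopic_refl)
  have "?i \<in> hom ?V ?W"
    unfolding hom_def
  proof (intro CollectI conjI ballI funcsetI)
    show "?i A \<in> carrier ?W" if "A \<in> carrier ?V" for A
      using that ind comp by (auto simp: cV cW)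
    fix A B assume "A \<in> carrier ?V" "B \<in> carrier ?V"
    then obtain g h where g: "g \<in> spheroids n V y" "A = spheroid_class n V y g"
      and h: "h \<in> spheroids n V y" "B = spheroid_class n V y h"
      by (auto simp: cV)
    show "?i (A \<otimes>\<^bsub>?V\<^esub> B) = ?i A \<otimes>\<^bsub>?W\<^esub> ?i B"
      unfolding g(2) h(2) mult_homotopy_group[OF n g(1) h(1)] ind[OF concat[OF g(1) h(1)]]
        ind[OF g(1)] ind[OF h(1)] mult_homotopy_group[OF n comp[OF g(1)] comp[OF h(1)]]
        compose_spheroid_concat ..
  qed
  moreover have "inj_on ?i (carrier ?V)"
  proof (rule inj_onI)
    fix A B assume "A \<in> carrier ?V" "B \<in> carrier ?V" and eq: "?i A = ?i B"
    then obtain g h where g: "g \<in> spheroids n V y" "A = spheroid_class n V y g"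
      and h: "h \<in> spheroids n V y" "B = spheroid_class n V y h"
      by (auto simp: cV)
    have "spheroid_homotopic n W (f y) (f \<circ> g) (f \<circ> h)"
      using eq g h comp[OF h(1)] by (simp add: ind spheroid_class_eq_iff)
    then have "spheroid_homotopic n V y g h"
      by (rule relative_lifting_spheroid_homotopy[OF f(1) y g(1) h(1)])
    then show "A = B" unfolding g h by (rule spheroid_class_eq)
  qed
  moreover have "carrier ?W \<subseteq> ?i ` carrier ?V"
  proof
    fix B assume "B \<in> carrier ?W"
    then obtain b where b: "b \<in> spheroids n W (f y)" "B = spheroid_class n W (f y) b"
      by (auto simp: cW)
    obtain g where g: "g \<in> spheroids n V y" "spheroid_homotopic n W (f y) b (f \<circ> g)"
      by (rule relative_lifting_spheroid[OF f(1) y b(1)])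
    then have "B = ?i (spheroid_class n V y g)"
      using b ind[OF g(1)] spheroid_class_eq by metis
    then show "B \<in> ?i ` carrier ?V" using g(1) by (auto simp: cV)
  qed
  ultimately show ?thesis
    unfolding iso_def bij_betw_def hom_def by blast
qed

theorem relative_lifting_imp_weak_homotopy_equivalence:
  assumes "relative_lifting V W f" "continuous_map V W f"
  shows "weak_homotopy_equivalence V W f"
  unfolding weak_homotopy_equivalence_def
  by (intro conjI allI impI ballI assms relative_lifting_path_components
      relative_lifting_homotopy_group_iso)

section \<open>An Alexandroff space and its space of chains\<close>

lemma homeomorphic_maps_pullback_inv:
  fixes X :: "'a topology"
  assumes "inj i"
  shows "homeomorphic_maps X (pullback_topology (range i) (inv_into UNIV i) X) i (inv_into UNIV i)"
  unfolding homeomorphic_maps_def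
proof (intro conjI ballI)
  let ?X = "pullback_topology (range i) (inv_into UNIV i) X"
  show "continuous_map X ?X i"
    unfolding continuous_map_def
  proof (intro conjI allI impI)
    show "i \<in> topspace X \<rightarrow> topspace ?X" using assms by (auto simp: topspace_pullback_topology)
    fix U assume "openin ?X U"
    then obtain T where T: "openin X T" "U = inv_into UNIV i -` T \<inter> range i"
      by (auto simp: openin_pullback_topology)
    then have "{x \<in> topspace X. i x \<in> U} = T" using assms openin_subset[OF T(1)] by auto
    then show "openin X {x \<in> topspace X. i x \<in> U}" using T by simp
  qed
  show "continuous_map ?X X (inv_into UNIV i)"
    unfolding continuous_map_def openin_pullback_topology topspace_pullback_topology
    using openin_subset by fastforce
qed (use assms in \<open>auto simp: topspace_pullback_topology f_inv_into_f\<close>)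

text \<open>
  The constant functions with values in the two summands provide the copies of \<open>X\<close> and of the space of
  chains in the common type; between them the zigzag is the single arrow induced by \<open>chain_top\<close>.
\<close>

lemma weakly_homotopy_equivalent_chain_space:
  fixes X :: "'a topology"
  assumes X: "alexandroff_space X"
  shows "weakly_homotopy_equivalent X (chain_space X)"
proof -
  define i :: "'a \<Rightarrow> real \<Rightarrow> 'a + 'a set" where "i x = (\<lambda>_. Inl x)" for x
  define j :: "'a set \<Rightarrow> real \<Rightarrow> 'a + 'a set" where "j C = (\<lambda>_. Inr C)" for C
  define X' where "X' = pullback_topology (range i) (inv_into UNIV i) X"
  define Y' where "Y' = pullback_topology (range j) (inv_into UNIV j) (chain_space X)"
  have "inj i" "inj j" by (auto simp: i_def j_def inj_def fun_eq_iff)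
  then have i: "homeomorphic_maps X X' i (inv_into UNIV i)"
    and j: "homeomorphic_maps (chain_space X) Y' j (inv_into UNIV j)"
    unfolding X'_def Y'_def by (simp_all add: homeomorphic_maps_pullback_inv)
  let ?f = "i \<circ> chain_top X \<circ> inv_into UNIV j"
  have "relative_lifting Y' X' ?f"
    by (rule relative_lifting_homeomorphic[OF relative_lifting_chain_top[OF X] continuous_map_chain_top[OF X] j i])
  moreover have "continuous_map Y' X' ?f"
    using i j continuous_map_chain_top[OF X] unfolding homeomorphic_maps_def
    by (intro continuous_map_compose) auto
  ultimately have "weak_homotopy_equivalence Y' X' ?f"
    by (rule relative_lifting_imp_weak_homotopy_equivalence)
  then have "\<exists>f. weak_homotopy_equivalence Y' X' f" by (rule exI[where x = ?f])
  then have "equivclp (\<lambda>V W. \<exists>f. weak_homotopy_equivalence V W f) X' Y'"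
    by (rule converse_r_into_equivclp)
  moreover have "X homeomorphic_space X'" "chain_space X homeomorphic_space Y'"
    using i j unfolding homeomorphic_space_def by blast+
  ultimately show ?thesis unfolding weakly_homotopy_equivalent_def by blast
qed

theorem proposition14:
  fixes X :: "'a topology"
  assumes "t0_space X" and "alexandroff_space X"
  shows "\<exists>(Y :: 'a set topology) \<phi>.
           weakly_homotopy_equivalent X Y \<and>
           embedding_map Y (usf_hyperspace (topspace X)) \<phi> \<and>
           openin (usf_hyperspace (topspace X)) (\<phi> ` topspace Y) \<and>
           (locally_finite_space X \<longrightarrow>
              embedding_map Y (finite_usf_hyperspace (topspace X)) \<phi>)"
proof (intro exI conjI impI)
  have emb: "embedding_map (chain_space X) (usf_hyperspace (topspace X)) id"
    unfolding embedding_map_def chain_space_def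
    by (simp add: subtopology_restrict homeomorphic_map_id)
  show "weakly_homotopy_equivalent X (chain_space X)"
    using assms(2) by (rule weakly_homotopy_equivalent_chain_space)
  show "embedding_map (chain_space X) (usf_hyperspace (topspace X)) id"
    by (rule emb)
  show "openin (usf_hyperspace (topspace X)) (id ` topspace (chain_space X))"
    by (simp add: topspace_chain_space openin_finite_chains)
  show "embedding_map (chain_space X) (finite_usf_hyperspace (topspace X)) id"
    unfolding finite_usf_hyperspace_def embedding_map_in_subtopology
    using emb by (auto simp: topspace_chain_space finite_chains_def)
qed

end
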